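(* Let $u$ be a nonzero integer square (i.e. $u=n^2$ for an integer $n\ge 1$) such that $p=4u^{2}+12u+1$ is a prime. Let $\alpha$ be a primitive element of $\mathbb{F}_p$ and, for $0\le i\le 7$, let $C_i^8=\alpha^i\langle\alpha^8\rangle$. Then, depending on the choice of $\alpha$, at least one of the following holds: (1) Both $(C_{0}^{8} \cup C_{1}^{8},\,C_{4}^{8} \cup C_{5}^{8})$ and $(C_{0}^{8} \cup C_{7}^{8},\,C_{3}^{8} \cup C_{4}^{8})$ are $(\frac{p-1}{4}, \frac{p-1}{4})$-$\frac{p-1}{16}$-fold near-factorizations of the additive group $(\mathbb{F}_p,+)$. (2) Both $(C_{0}^{8} \cup C_{5}^{8},\,C_{1}^{8} \cup C_{4}^{8})$ and $(C_{0}^{8} \cup C_{3}^{8},\,C_{4}^{8} \cup C_{7}^{8})$ are $(\frac{p-1}{4}, \frac{p-1}{4})$-$\frac{p-1}{16}$-fold near-factorizations of the additive group $(\mathbb{F}_p,+)$.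
   Context: For a finite group $G$ (here the additive group of $\mathbb{F}_p$, with identity $0$), subsets $S,T\subseteq G$ and a positive integer $\lambda$, the pair $(S,T)$ is a $\lambda$-fold near-factorization of $G$ if every non-identity element $g\in G$ can be written as $g=st$ (here $g=s+t$) with $s\in S$, $t\in T$ in exactly $\lambda$ distinct ways, while the identity is not represented; equivalently $ST=\lambda(G-e)$ in the group ring $\mathbb{Z}[G]$. It is an $(s,t)$-$\lambda$-fold near-factorization if moreover $|S|=s$ and $|T|=t$. For a prime $p\equiv 1\pmod 8$ and a primitive element $\alpha$ of $\mathbb{F}_p$, $C_i^8=\alpha^i\langle\alpha^8\rangle$ denotes the $i$-th cyclotomic coset of order $8$ (the coset of the index-$8$ subgroup of $\mathbb{F}_p^*$); these depend on $\alpha$. *)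

theory Defs
  imports "HOL-Number_Theory.Residues"
begin

definition near_factorization ::
    "('a, 'm) monoid_scheme \<Rightarrow> nat \<Rightarrow> 'a set \<Rightarrow> 'a set \<Rightarrow> bool"
  where "near_factorization G l S T \<longleftrightarrow>
    group G \<and> finite (carrier G) \<and> l > 0 \<and> S \<subseteq> carrier G \<and> T \<subseteq> carrier G \<and>
    (\<forall>g \<in> carrier G - {\<one>\<^bsub>G\<^esub>}. card {(s, t). s \<in> S \<and> t \<in> T \<and> s \<otimes>\<^bsub>G\<^esub> t = g} = l) \<and>
    (\<forall>s \<in> S. \<forall>t \<in> T. s \<otimes>\<^bsub>G\<^esub> t \<noteq> \<one>\<^bsub>G\<^esub>)"

definition sized_near_factorization ::
    "('a, 'm) monoid_scheme \<Rightarrow> nat \<Rightarrow> nat \<Rightarrow> nat \<Rightarrow> 'a set \<Rightarrow> 'a set \<Rightarrow> bool"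
  where "sized_near_factorization G a b l S T \<longleftrightarrow>
    near_factorization G l S T \<and> card S = a \<and> card T = b"

definition primitive_element :: "('a, 'm) ring_scheme \<Rightarrow> 'a \<Rightarrow> bool"
  where "primitive_element F \<alpha> \<longleftrightarrow>
    \<alpha> \<in> carrier (mult_of F) \<and> generate (mult_of F) {\<alpha>} = carrier (mult_of F)"

definition cyclotomic_coset :: "('a, 'm) ring_scheme \<Rightarrow> nat \<Rightarrow> 'a \<Rightarrow> nat \<Rightarrow> 'a set"
  where "cyclotomic_coset F e \<alpha> i =
    (\<alpha> [^]\<^bsub>mult_of F\<^esub> i) <#\<^bsub>mult_of F\<^esub>
      generate (mult_of F) {\<alpha> [^]\<^bsub>mult_of F\<^esub> e}"

text \<open>
  For \<open>p = 4u\<^sup>2 + 12u + 1\<close> with \<open>u = n\<^sup>2\<close> one has \<open>p - 1 = 4u(u + 3)\<close>, which is a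
  multiple of 16; hence the natural-number quotients \<open>(p - 1) div 4\<close> and \<open>(p - 1) div 16\<close>
  are exact.
\<close>

lemma sixteen_dvd:
  fixes n u p :: nat
  assumes "u = n ^ 2" and "p = 4 * u ^ 2 + 12 * u + 1"
  shows "16 dvd p - 1"
proof -
  have "4 dvd u * (u + 3)"
  proof (cases "even n")
    case True
    then obtain m where "n = 2 * m" by (elim evenE)
    then have "u = 4 * m ^ 2" using assms(1) by (simp add: power2_eq_square)
    then show ?thesis by simp
  next
    case False
    then obtain m where "n = 2 * m + 1" by (elim oddE)
    then have "u + 3 = 4 * (m ^ 2 + m + 1)"
      using assms(1) by (simp add: power2_eq_square algebra_simps)
    then show ?thesis by (metis dvd_mult dvd_triv_left)
  qed
  then have "4 * 4 dvd 4 * (u * (u + 3))" by (rule mult_dvd_mono[OF dvd_refl])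
  moreover have "p - 1 = 4 * (u * (u + 3))"
    using assms(2) by (simp add: power2_eq_square algebra_simps)
  ultimately show ?thesis by simp
qed

end

theory Submission
  imports Defs Complex_Main "HOL-Library.Z2" "HOL-Library.Disjoint_Sets" "HOL-Number_Theory.Modular_Inverse"
begin

text \<open>
  Let \<open>\<chi>\<close> be an octic character of \<open>\<F>\<^sub>p\<close> and \<open>\<eta>\<^sub>i\<close> the Gaussian period of \<open>C\<^sub>i\<close>. By Fourier
  inversion \<open>(C\<^sub>i \<union> C\<^sub>i\<^sub>+\<^sub>1, C\<^sub>i\<^sub>+\<^sub>4 \<union> C\<^sub>i\<^sub>+\<^sub>5)\<close> is a near-factorization for every \<open>i\<close> as soon as
  \<open>(\<eta>\<^sub>i + \<eta>\<^sub>i\<^sub>+\<^sub>1) (\<eta>\<^sub>i\<^sub>+\<^sub>4 + \<eta>\<^sub>i\<^sub>+\<^sub>5) = - (p - 1) / 16\<close> for every \<open>i\<close>. Expressing the periods by Gauss sums,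
  and products of Gauss sums by the Jacobi sums \<open>J(\<chi>, \<chi>\<^sup>4) = a + b\<surd>-2\<close> and \<open>J(\<chi>\<^sup>2, \<chi>\<^sup>4) = x + y\<i>\<close>, this
  product formula reduces to \<open>y = 2b\<close> and \<open>a + x = -2\<epsilon>\<close>, where \<open>\<epsilon> = \<chi>(4) = \<plusminus>1\<close>. Now
  \<open>p = a\<^sup>2 + 2b\<^sup>2 = x\<^sup>2 + y\<^sup>2\<close>, while also \<open>p = (2u + 1)\<^sup>2 + 2(2n)\<^sup>2 = (2u - 1)\<^sup>2 + (4n)\<^sup>2\<close>; as such
  representations are unique, \<open>a\<close>, \<open>b\<close>, \<open>x\<close>, \<open>y\<close> are known up to sign. The congruences
  \<open>a \<equiv> x \<equiv> -1 (mod 4)\<close> fix the signs of \<open>a\<close> and \<open>x\<close>, and \<open>\<epsilon>\<close> is read off from the parity of the number of \<open>t\<close>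
  with \<open>t\<close> and \<open>1 - t\<close> both fourth powers, which \<open>t \<mapsto> 1 - t\<close> pairs up except for \<open>t = 1/2\<close>.
  This gives \<open>a + x = -2\<epsilon>\<close> and \<open>y = \<plusminus>2b\<close>. If \<open>y = -2b\<close>, then passing from \<open>\<chi>\<close> to \<open>\<chi>\<^sup>5\<close> changes the
  sign of \<open>b\<close> and permutes the cosets by \<open>i \<mapsto> 5i\<close>, which is the second alternative.
\<close>

subsection \<open>Preliminaries\<close>

text \<open>Counting in the field with two elements, \<open>x\<close> and \<open>f x\<close> cancel
  as 1 + 1 = 0. An infinite \<open>A\<close> is covered as well, since its \<open>card\<close> is
  0.\<close>

lemma even_card_involution:
  assumes "\<And>x. x \<in> A \<Longrightarrow> f x \<in> A" "\<And>x. x \<in> A \<Longrightarrow> f (f x) = x" "\<And>x. x \<in> A \<Longrightarrow> f x \<noteq> x"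
  shows "even (card A)"
proof -
  have "(\<Sum>x\<in>A. 1 :: bit) = 0"
    by (rule sum_involution_eq_0[where h = f]) (use assms in auto)
  moreover have "(of_nat n :: bit) = 0 \<longleftrightarrow> even n" for n
    by (induction n) auto
  ultimately show ?thesis by simp
qed

text \<open>The signs -1 occur in pairs, and each such pair lowers the sum by 4 from the number of
  elements.\<close>

lemma sum_signs_cong_card:
  fixes s :: "'a \<Rightarrow> int"
  assumes "finite A" "\<And>x. x \<in> A \<Longrightarrow> f x \<in> A" "\<And>x. x \<in> A \<Longrightarrow> f (f x) = x" "\<And>x. x \<in> A \<Longrightarrow> f x \<noteq> x"
    and s: "\<And>x. x \<in> A \<Longrightarrow> s x = 1 \<or> s x = -1" and inv: "\<And>x. x \<in> A \<Longrightarrow> s (f x) = s x"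
  shows "[sum s A = int (card A)] (mod 4)"
proof -
  let ?N = "{x \<in> A. s x = -1}"
  have "even (card ?N)"
    by (rule even_card_involution[of _ f]) (use assms in auto)
  then obtain k where k: "card ?N = 2 * k" by (elim evenE)
  have "sum s A = (\<Sum>x\<in>A. 1 - 2 * (if s x = -1 then 1 else 0))"
    by (rule sum.cong) (use s in auto)
  also have "\<dots> = int (card A) - 2 * (\<Sum>x\<in>A. if s x = -1 then 1 else 0)"
    by (simp add: sum_subtractf sum_distrib_left)
  also have "(\<Sum>x\<in>A. if s x = -1 then 1 else (0::int)) = int (card ?N)"
    using assms(1) by (simp add: sum.If_cases Int_def)
  finally have "sum s A = int (card A) - 4 * int k" using k by simp
  then show ?thesis by (simp add: cong_iff_dvd_diff)
qed

text \<open>Multiplying the two representations gives two representations of \<open>p^2\<close>, in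
  one of which \<open>p\<close> divides the second coordinate. The parity hypotheses keep the first
  coordinate nonzero; for \<open>N = 1\<close> this rules out interchanging the two squares.\<close>

lemma prime_quadratic_form_unique:
  fixes p a b c f N :: int
  assumes "prime p" "p = a\<^sup>2 + N * b\<^sup>2" "p = c\<^sup>2 + N * f\<^sup>2" "N \<ge> 1"
    and "odd (a * c)" "even (N * (b * f))"
  shows "a\<^sup>2 = c\<^sup>2" "b\<^sup>2 = f\<^sup>2"
proof -
  \<comment> \<open>A nonzero multiple of \<open>p\<close> as second coordinate would already use up
    all of \<open>p^2\<close>, leaving no room for an odd \<open>l\<close>.\<close>
  have zero: "m = 0" if "p dvd m" "p\<^sup>2 = l\<^sup>2 + N * m\<^sup>2" "odd l" for l m
  proof (rule ccontr)
    assume "m \<noteq> 0"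
    then have "p\<^sup>2 \<le> m\<^sup>2" using dvd_imp_le_int[OF _ that(1)] by (simp add: abs_le_square_iff)
    moreover have "1 * m\<^sup>2 \<le> N * m\<^sup>2" by (rule mult_right_mono) (use assms(4) in auto)
    moreover have "l\<^sup>2 > 0" using that(3) by (cases "l = 0") auto
    ultimately show False using that(2) by simp
  qed
  have "a\<^sup>2 * f\<^sup>2 - b\<^sup>2 * c\<^sup>2 = (p - N * b\<^sup>2) * f\<^sup>2 - b\<^sup>2 * (p - N * f\<^sup>2)"
    using assms(2,3) by (metis add_diff_cancel_right')
  also have "\<dots> = p * (f\<^sup>2 - b\<^sup>2)" by (simp add: algebra_simps)
  finally have *: "a\<^sup>2 * f\<^sup>2 - b\<^sup>2 * c\<^sup>2 = p * (f\<^sup>2 - b\<^sup>2)" .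
  have "(a * f - b * c) * (a * f + b * c) = a\<^sup>2 * f\<^sup>2 - b\<^sup>2 * c\<^sup>2"
    by (simp add: power2_eq_square algebra_simps)
  then have "p dvd (a * f - b * c) * (a * f + b * c)" by (simp add: *)
  then have "p dvd a * f - b * c \<or> p dvd a * f + b * c"
    using assms(1) prime_dvd_mult_iff by blast
  \<comment> \<open>Brahmagupta's identity, for both choices of sign.\<close>
  moreover have "p\<^sup>2 = (a * c + N * (b * f))\<^sup>2 + N * (a * f - b * c)\<^sup>2"
    "p\<^sup>2 = (a * c - N * (b * f))\<^sup>2 + N * (a * f + b * c)\<^sup>2"
  proof -
    have "p\<^sup>2 = (a\<^sup>2 + N * b\<^sup>2) * (c\<^sup>2 + N * f\<^sup>2)"
      using assms(2,3) by (metis power2_eq_square)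
    then show "p\<^sup>2 = (a * c + N * (b * f))\<^sup>2 + N * (a * f - b * c)\<^sup>2"
      "p\<^sup>2 = (a * c - N * (b * f))\<^sup>2 + N * (a * f + b * c)\<^sup>2"
      by (simp_all add: power2_eq_square algebra_simps)
  qed
  moreover have "odd (a * c + N * (b * f))" "odd (a * c - N * (b * f))" using assms(5,6) by simp_all
  ultimately have "a * f - b * c = 0 \<or> a * f + b * c = 0" using zero by blast
  then have "a\<^sup>2 * f\<^sup>2 - b\<^sup>2 * c\<^sup>2 = 0"
    using \<open>(a * f - b * c) * (a * f + b * c) = a\<^sup>2 * f\<^sup>2 - b\<^sup>2 * c\<^sup>2\<close> by auto
  with * show "b\<^sup>2 = f\<^sup>2" using assms(1) by auto
  then show "a\<^sup>2 = c\<^sup>2" using assms(2,3) by simp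
qed

section \<open>Powers of a primitive eighth root of unity\<close>

definition zeta :: complex where "zeta = Complex (sqrt 2 / 2) (sqrt 2 / 2)"

lemma zeta_2: "zeta ^ 2 = \<i>"
  by (simp add: zeta_def power2_eq_square complex_eq_iff)

lemma zeta_powers:
  "zeta ^ 3 = \<i> * zeta" "zeta ^ 4 = -1" "zeta ^ 5 = - zeta" "zeta ^ 6 = - \<i>"
  "zeta ^ 7 = - (\<i> * zeta)" "zeta ^ 8 = 1"
proof -
  show z3: "zeta ^ 3 = \<i> * zeta" by (simp add: power3_eq_cube flip: zeta_2) (simp add: power2_eq_square)
  show z4: "zeta ^ 4 = -1" using zeta_2 by (metis i_squared power2_eq_square power_add numeral_Bit0)
  have "zeta ^ (4 + 1) = - zeta" "zeta ^ (4 + 2) = - \<i>" "zeta ^ (4 + 3) = - (\<i> * zeta)" "zeta ^ (4 + 4) = 1"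
    unfolding power_add z4 z3 zeta_2 by simp_all
  then show "zeta ^ 5 = - zeta" "zeta ^ 6 = - \<i>" "zeta ^ 7 = - (\<i> * zeta)" "zeta ^ 8 = 1" by simp_all
qed

lemma zeta_pow_mod: "zeta ^ (k mod 8) = zeta ^ k"
proof -
  have "zeta ^ k = zeta ^ (8 * (k div 8) + k mod 8)" by simp
  also have "\<dots> = zeta ^ (k mod 8)" by (simp only: power_add power_mult zeta_powers power_one mult_1)
  finally show ?thesis by simp
qed

lemma zeta_pow_cong: "[k = l] (mod 8) \<Longrightarrow> zeta ^ k = zeta ^ l"
  by (metis zeta_pow_mod Cong.cong_def)

lemma zeta_pow_eq_1_iff: "zeta ^ k = 1 \<longleftrightarrow> 8 dvd k"
proof -
  have "k mod 8 \<in> {0,1,2,3,4,5,6,7}" by auto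
  then have "zeta ^ (k mod 8) = 1 \<longleftrightarrow> k mod 8 = 0"
    by (elim insertE; simp add: zeta_powers zeta_2; simp add: zeta_def complex_eq_iff)
  then show ?thesis by (simp add: zeta_pow_mod mod_eq_0_iff_dvd)
qed

lemma sum_zeta_pow: "(\<Sum>j<8. zeta ^ (j * k)) = (if 8 dvd k then 8 else 0)"
proof (cases "8 dvd k")
  case True
  then have "zeta ^ k = 1" by (simp add: zeta_pow_eq_1_iff)
  then show ?thesis using True by (simp add: mult.commute[of _ k] power_mult)
next
  case False
  then have "zeta ^ k \<noteq> 1" by (simp add: zeta_pow_eq_1_iff)
  then have "(\<Sum>j<8. (zeta ^ k) ^ j) = ((zeta ^ k) ^ 8 - 1) / (zeta ^ k - 1)" by (rule geometric_sum)
  also have "(zeta ^ k) ^ 8 = 1" by (metis mult.commute power_mult power_one zeta_powers(6))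
  finally show ?thesis using False by (simp add: mult.commute[of _ k] power_mult)
qed

text \<open>
  The \<open>g\<^sub>j\<close> stand for Gauss sums of \<open>\<chi>\<^sup>j\<close> twisted by \<open>j\<close>-th powers of an eighth root of unity, so that one identity
  covers all shifts of the coset indices.
\<close>

lemma octic_period_identity:
  fixes g1 g2 g3 g4 g5 g6 g7 z a b x \<epsilon> q :: complex
  defines "t \<equiv> z * (1 + \<i>)"
  assumes z: "z\<^sup>2 = \<i>" and eps: "\<epsilon>\<^sup>2 = 1" and x: "a + x = - 2 * \<epsilon>"
    and g: "g1 * g1 = \<epsilon> * (a + b * t) * g2" "g5 * g5 = \<epsilon> * (a - b * t) * g2"
      "g3 * g3 = \<epsilon> * (a + b * t) * g6" "g7 * g7 = \<epsilon> * (a - b * t) * g6"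
      "g1 * g3 = (a + b * t) * g4" "g5 * g7 = (a - b * t) * g4"
      "g1 * g5 = \<epsilon> * (x + 2 * \<i> * b) * g6" "g3 * g7 = \<epsilon> * (x - 2 * \<i> * b) * g2"
      "g2 * g2 = (x + 2 * \<i> * b) * g4" "g6 * g6 = (x - 2 * \<i> * b) * g4"
      "g1 * g7 = q" "g3 * g5 = q" "g2 * g6 = q"
  shows "(- 2 + (1 - \<i>) * g2 + (1 + \<i>) * g6)\<^sup>2 -
    ((1 - \<i> * z) * g1 + (1 - z) * g3 + (1 + \<i> * z) * g5 + (1 + z) * g7)\<^sup>2 = 4 - 4 * q"
proof -
  have zz: "z * z = \<i>" "z * (z * y) = \<i> * y" for y using z by (simp_all add: power2_eq_square flip: mult.assoc)
  have ii: "\<i> * (\<i> * y) = - y" for y by (simp flip: mult.assoc)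
  have ee: "\<epsilon> * \<epsilon> = 1" "\<epsilon> * (\<epsilon> * y) = y" for y using eps by (simp_all add: power2_eq_square flip: mult.assoc)
  have x': "x = - 2 * \<epsilon> - a" using x by (simp add: algebra_simps eq_neg_iff_add_eq_0)
  have E: "(- 2 + (1 - \<i>) * g2 + (1 + \<i>) * g6)\<^sup>2 = 4 - 4 * (1 - \<i>) * g2 - 4 * (1 + \<i>) * g6
      - 2 * \<i> * (g2 * g2) + 2 * \<i> * (g6 * g6) + 4 * (g2 * g6)"
    by (simp add: power2_eq_square algebra_simps ii)
  have O: "((1 - \<i> * z) * g1 + (1 - z) * g3 + (1 + \<i> * z) * g5 + (1 + z) * g7)\<^sup>2 =
      (1 - \<i> - 2 * \<i> * z) * (g1 * g1) + (1 - \<i> + 2 * \<i> * z) * (g5 * g5)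
      + (1 + \<i> - 2 * z) * (g3 * g3) + (1 + \<i> + 2 * z) * (g7 * g7)
      - 2 * t * (g1 * g3) + 2 * t * (g5 * g7)
      + 2 * (1 + \<i>) * (g1 * g5) + 2 * (1 - \<i>) * (g3 * g7)
      + 2 * (1 + z + 1 - \<i> * z) * (g1 * g7) + 2 * (1 - z + \<i> * z + 1) * (g3 * g5)"
    by (simp add: t_def power2_eq_square algebra_simps ii zz)
  \<comment> \<open>Coefficients of \<open>g2\<close>, \<open>g6\<close> and \<open>g4\<close> in
    the expanded square. In the first two, \<open>b\<close> cancels because \<open>z * t\<close>
    equals \<open>\<i> - 1\<close>, and \<open>a + x = - 2 * \<epsilon>\<close> settles the rest;
    the third uses that \<open>t\<close> squares to -2.\<close>
  have 2: "(1 - \<i> - 2 * \<i> * z) * (\<epsilon> * (a + b * t)) + (1 - \<i> + 2 * \<i> * z) * (\<epsilon> * (a - b * t))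
      + 2 * (1 - \<i>) * (\<epsilon> * (x - 2 * \<i> * b)) = - 4 * (1 - \<i>)"
    unfolding x' by (simp add: t_def algebra_simps ii zz ee)
  have 6: "(1 + \<i> - 2 * z) * (\<epsilon> * (a + b * t)) + (1 + \<i> + 2 * z) * (\<epsilon> * (a - b * t))
      + 2 * (1 + \<i>) * (\<epsilon> * (x + 2 * \<i> * b)) = - 4 * (1 + \<i>)"
    unfolding x' by (simp add: t_def algebra_simps ii zz ee)
  have 4: "- 2 * t * (a + b * t) + 2 * t * (a - b * t) = - 2 * \<i> * (x + 2 * \<i> * b) + 2 * \<i> * (x - 2 * \<i> * b)"
    by (simp add: t_def algebra_simps ii zz)
  have "((1 - \<i> * z) * g1 + (1 - z) * g3 + (1 + \<i> * z) * g5 + (1 + z) * g7)\<^sup>2 =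
      ((1 - \<i> - 2 * \<i> * z) * (\<epsilon> * (a + b * t)) + (1 - \<i> + 2 * \<i> * z) * (\<epsilon> * (a - b * t))
        + 2 * (1 - \<i>) * (\<epsilon> * (x - 2 * \<i> * b))) * g2 +
      ((1 + \<i> - 2 * z) * (\<epsilon> * (a + b * t)) + (1 + \<i> + 2 * z) * (\<epsilon> * (a - b * t))
        + 2 * (1 + \<i>) * (\<epsilon> * (x + 2 * \<i> * b))) * g6 +
      (- 2 * t * (a + b * t) + 2 * t * (a - b * t)) * g4 + 8 * q"
    unfolding O g by (simp add: algebra_simps)
  also have "\<dots> = - 4 * (1 - \<i>) * g2 - 4 * (1 + \<i>) * g6
      + (- 2 * \<i> * (x + 2 * \<i> * b) + 2 * \<i> * (x - 2 * \<i> * b)) * g4 + 8 * q"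
    unfolding 2 6 4 by (simp add: algebra_simps)
  finally show ?thesis unfolding E g by (simp add: algebra_simps)
qed

subsection \<open>Sums over residues modulo a prime\<close>

locale prime_modulus =
  fixes p :: int
  assumes prime: "prime p"
begin

abbreviation R :: "int set" where "R \<equiv> {0..<p}"

lemma p_pos: "p > 1" using prime by (simp add: prime_gt_1_int)

text \<open>Functions on the field are modelled as functions on all integers, so that arguments such
  as \<open>c * x + b\<close> need no reduction.\<close>

definition periodic :: "(int \<Rightarrow> 'a) \<Rightarrow> bool"
  where "periodic f \<longleftrightarrow> (\<forall>x. f (x mod p) = f x)"

lemma periodicD: "periodic f \<Longrightarrow> f (x mod p) = f x"
  by (simp add: periodic_def)

lemma periodic_cong: "periodic f \<Longrightarrow> [x = y] (mod p) \<Longrightarrow> f x = f y"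
  by (metis periodicD Cong.cong_def)

lemma inj_affine: "\<not> p dvd c \<Longrightarrow> inj_on (\<lambda>x. (c * x + b) mod p) R"
proof (rule inj_onI)
  fix x y assume c: "\<not> p dvd c" and xy: "x \<in> R" "y \<in> R" "(c * x + b) mod p = (c * y + b) mod p"
  then have "p dvd c * (x - y)" by (simp add: mod_eq_dvd_iff algebra_simps)
  then have "p dvd x - y" using c prime prime_dvd_mult_iff by blast
  then have "x mod p = y mod p" by (simp add: mod_eq_dvd_iff)
  then show "x = y" using xy by simp
qed

lemma bij_affine:
  assumes "\<not> p dvd c"
  shows "bij_betw (\<lambda>x. (c * x + b) mod p) R R"
proof -
  have "(\<lambda>x. (c * x + b) mod p) ` R \<subseteq> R" using p_pos by auto
  then have "(\<lambda>x. (c * x + b) mod p) ` R = R"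
    using inj_affine[OF assms, of b] by (intro endo_inj_surj) auto
  with inj_affine[OF assms, of b] show ?thesis by (simp add: bij_betw_def)
qed

text \<open>The substitution rule behind most changes of variable in the character sums
  below.\<close>

lemma sum_affine:
  assumes "periodic f" "\<not> p dvd c"
  shows "(\<Sum>x\<in>R. f (c * x + b)) = (\<Sum>x\<in>R. f x)"
  using sum.reindex_bij_betw[OF bij_affine[OF assms(2), of b], of f] assms(1)
  by (simp add: periodicD)

abbreviation minv :: "int \<Rightarrow> int" where "minv \<equiv> modular_inverse p"

lemma coprime_iff_not_dvd: "coprime x p \<longleftrightarrow> \<not> p dvd x"
  using prime by (metis coprime_absorb_right coprime_commute not_prime_unit prime_imp_coprime)

lemma minv:
  assumes "\<not> p dvd x"
  shows "minv x \<in> R" "[x * minv x = 1] (mod p)" "\<not> p dvd minv x"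
  using assms p_pos cong_modular_inverse1[of x p] coprime_modular_inverse[of x p]
  by (auto simp: modular_inverse_int_nonneg modular_inverse_int_less coprime_iff_not_dvd)

lemma minv_minv: assumes "\<not> p dvd x" "x \<in> R" shows "minv (minv x) = x"
  by (rule modular_inverse_int_eqI) (use assms minv[OF assms(1)] in \<open>auto simp: mult.commute\<close>)

lemma minv_fixed: assumes "\<not> p dvd x" "x \<in> R" "minv x = x" shows "x = 1 \<or> x = p - 1"
proof -
  have "[x * x = 1] (mod p)" using minv(2)[OF assms(1)] assms(3) by simp
  then have "p dvd (x - 1) * (x + 1)" by (simp add: cong_iff_dvd_diff algebra_simps)
  then have "p dvd x - 1 \<or> p dvd x + 1" using prime prime_dvd_mult_iff by blast
  then show ?thesis
  proof
    assume "p dvd x - 1"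
    then have "x mod p = 1 mod p" by (simp add: mod_eq_dvd_iff)
    then show ?thesis using assms(2) p_pos by simp
  next
    assume "p dvd x + 1"
    then have "p \<le> x + 1" using assms(2) zdvd_imp_le by force
    then show ?thesis using assms(2) by simp
  qed
qed

section \<open>The additive character and Fourier inversion\<close>

definition e :: "int \<Rightarrow> complex"
  where "e x = cis (2 * pi * (of_int x / of_int p))"

lemma e_add: "e (x + y) = e x * e y"
  by (simp add: e_def cis_mult add_divide_distrib algebra_simps)

lemma e_0 [simp]: "e 0 = 1" by (simp add: e_def)

lemma e_multiple: "e (p * k) = 1"
  using p_pos by (simp add: e_def cis_multiple_2pi)

lemma periodic_e: "periodic e"
  unfolding periodic_def
proof
  fix x show "e (x mod p) = e x"
    using e_add[of "p * (x div p)" "x mod p"] by (simp add: e_multiple)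
qed

lemma e_1: "e 1 \<noteq> 1"
proof
  assume "e 1 = 1"
  then have "cos (2 * pi * (1 / of_int p)) = 1" by (simp add: e_def complex_eq_iff)
  then obtain k :: int where "2 * pi * (1 / of_int p) = of_int k * 2 * pi"
    by (auto simp: cos_one_2pi_int)
  then have "1 = real_of_int (k * p)" using p_pos by (simp add: field_simps)
  then have "k * p = 1" by linarith
  then show False using p_pos by (simp add: zmult_eq_1_iff)
qed

text \<open>Translation by 1 multiplies the complete sum of \<open>e\<close> by \<open>e 1\<close>,
  which is not 1, so that sum vanishes.\<close>

lemma sum_e: "(\<Sum>x\<in>R. e (k * x)) = (if p dvd k then of_int p else 0)"
proof (cases "p dvd k")
  case True
  then obtain m where "k = p * m" by (elim dvdE)
  then show ?thesis using p_pos by (simp add: mult.assoc e_multiple)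
next
  case False
  have "(\<Sum>x\<in>R. e x) = (\<Sum>x\<in>R. e (1 * x + 1))"
    by (rule sum_affine[symmetric, OF periodic_e]) (use p_pos in auto)
  also have "\<dots> = e 1 * (\<Sum>x\<in>R. e x)"
    by (simp add: e_add sum_distrib_left mult.commute)
  finally have "(\<Sum>x\<in>R. e x) = e 1 * (\<Sum>x\<in>R. e x)" .
  then have "(\<Sum>x\<in>R. e x) = 0" using e_1 mult_cancel_right1 by blast
  then show ?thesis using sum_affine[OF periodic_e False, of 0] False by simp
qed

text \<open>Fourier inversion: the sum of \<open>e ((s + t - g) * k)\<close> over \<open>k\<close>
  detects whether \<open>s + t\<close> is \<open>g\<close>, and it factors into the two exponential
  sums controlled by \<open>prod\<close>.\<close>

lemma card_sum_representations:
  assumes AB: "A \<subseteq> R" "B \<subseteq> R" and g: "g \<in> R"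
    and card: "int (card A * card B) = int l * (p - 1)"
    and prod: "\<And>k. \<not> p dvd k \<Longrightarrow> (\<Sum>s\<in>A. e (k * s)) * (\<Sum>t\<in>B. e (k * t)) = - of_nat l"
  shows "card {(s, t). s \<in> A \<and> t \<in> B \<and> (s + t) mod p = g} = (if g = 0 then 0 else l)"
proof -
  let ?N = "{(s, t). s \<in> A \<and> t \<in> B \<and> (s + t) mod p = g}"
  have fin: "finite A" "finite B" using AB finite_subset by blast+
  have dvd_iff: "p dvd s + t - g \<longleftrightarrow> (s + t) mod p = g" for s t
    using g by (metis atLeastLessThan_iff mod_eq_dvd_iff mod_pos_pos_trivial)
  have N: "?N = {x \<in> A \<times> B. p dvd fst x + snd x - g}" by (auto simp: dvd_iff)
  have "of_int p * complex_of_nat (card ?N) = (\<Sum>x\<in>{x \<in> A \<times> B. p dvd fst x + snd x - g}. of_int p)"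
    unfolding N by simp
  also have "\<dots> = (\<Sum>x\<in>A \<times> B. if p dvd fst x + snd x - g then of_int p else 0)"
    using fin by (subst sum.inter_filter) auto
  also have "\<dots> = (\<Sum>(s, t)\<in>A \<times> B. \<Sum>k\<in>R. e ((s + t - g) * k))"
    unfolding sum_e by (simp add: case_prod_beta)
  also have "\<dots> = (\<Sum>s\<in>A. \<Sum>t\<in>B. \<Sum>k\<in>R. e (- g * k) * (e (k * s) * e (k * t)))"
    by (simp add: sum.cartesian_product[symmetric] algebra_simps flip: e_add)
  also have "\<dots> = (\<Sum>s\<in>A. \<Sum>k\<in>R. \<Sum>t\<in>B. e (- g * k) * (e (k * s) * e (k * t)))"
    by (rule sum.cong[OF refl], rule sum.swap)
  also have "\<dots> = (\<Sum>k\<in>R. \<Sum>s\<in>A. \<Sum>t\<in>B. e (- g * k) * (e (k * s) * e (k * t)))"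
    by (rule sum.swap)
  also have "\<dots> = (\<Sum>k\<in>R. e (- g * k) * ((\<Sum>s\<in>A. e (k * s)) * (\<Sum>t\<in>B. e (k * t))))"
    by (simp only: sum_product) (simp only: sum_distrib_left)
  \<comment> \<open>At \<open>k = 0\<close> the product is \<open>l * (p - 1)\<close>. Written as
    \<open>l * p - l\<close>, it leaves a remainder of the same form as for the other
    \<open>k\<close>.\<close>
  also have "\<dots> = (\<Sum>k\<in>R. (if k = 0 then of_nat l * of_int p else 0) - of_nat l * e (- g * k))"
  proof (rule sum.cong[OF refl])
    fix k assume k: "k \<in> R"
    show "e (- g * k) * ((\<Sum>s\<in>A. e (k * s)) * (\<Sum>t\<in>B. e (k * t))) =
        (if k = 0 then of_nat l * of_int p else 0) - of_nat l * e (- g * k)"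
    proof (cases "k = 0")
      case True
      have "complex_of_int (int (card A * card B)) = of_int (int l * (p - 1))" using card by simp
      then show ?thesis using True by (simp add: algebra_simps)
    next
      case False
      then have "\<not> p dvd k" using k by (auto dest: zdvd_imp_le)
      then show ?thesis using False by (simp add: prod)
    qed
  qed
  also have "\<dots> = of_nat l * of_int p - of_nat l * (\<Sum>k\<in>R. e (- g * k))"
    using p_pos by (simp add: sum_subtractf sum_distrib_left)
  also have "(\<Sum>k\<in>R. e (- g * k)) = (if g = 0 then of_int p else 0)"
  proof -
    have "p dvd - g \<longleftrightarrow> g = 0" using g by (auto dest: zdvd_imp_le)
    then show ?thesis by (simp only: sum_e)
  qed
  finally have "of_int p * complex_of_nat (card ?N) = of_int p * of_nat (if g = 0 then 0 else l)"
    by simp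
  then show ?thesis using p_pos by (simp only: mult_cancel_left of_int_eq_0_iff of_nat_eq_iff) simp
qed

end

subsection \<open>Octic Gauss and Jacobi sums\<close>

text \<open>
  \<open>d\<close> is a discrete logarithm modulo 8 on the integers prime to \<open>p\<close>; its values at multiples of \<open>p\<close>
  are irrelevant.
\<close>

locale octic_index = prime_modulus +
  fixes d :: "int \<Rightarrow> nat"
  assumes p_mod_16: "p mod 16 = 1"
    and d_periodic: "periodic d"
    and d_mult: "\<not> p dvd x \<Longrightarrow> \<not> p dvd y \<Longrightarrow> [d (x * y) = d x + d y] (mod 8)"
    and d_surj: "\<exists>g. \<not> p dvd g \<and> d g mod 8 = 1"
    and d_minus_1: "8 dvd d (-1)"
    and even_d_square: "\<not> p dvd x \<Longrightarrow> even (d x) \<Longrightarrow> \<exists>y. [y\<^sup>2 = x] (mod p)"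
begin

section \<open>The powers of an octic character\<close>

text \<open>The value at multiples of \<open>p\<close> is 0 even for the trivial character
  \<open>j = 0\<close>; the constants in \<open>G_0\<close> and \<open>Jac_0\<close> depend on
  this.\<close>

definition chi :: "nat \<Rightarrow> int \<Rightarrow> complex"
  where "chi j x = (if p dvd x then 0 else zeta ^ (j * d x))"

lemma p_ge: "p \<ge> 17" using p_pos p_mod_16 by presburger

lemma dvd_mod_iff_p [simp]: "p dvd x mod p \<longleftrightarrow> p dvd x" by (simp add: dvd_mod_iff)

lemma dvd_mult_iff_p: "p dvd x * y \<longleftrightarrow> p dvd x \<or> p dvd y"
  using prime prime_dvd_mult_iff by blast

lemma chi_periodic: "periodic (chi j)"
  using d_periodic by (simp add: periodic_def chi_def)

lemma chi_mult: "chi j (x * y) = chi j x * chi j y"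
proof (cases "p dvd x * y")
  case False
  then have "\<not> p dvd x" "\<not> p dvd y" by (auto simp: dvd_mult_iff_p)
  then have "[j * d (x * y) = j * d x + j * d y] (mod 8)"
    using cong_mult[OF cong_refl[of j] d_mult] by (simp add: distrib_left)
  then have "zeta ^ (j * d (x * y)) = zeta ^ (j * d x + j * d y)" by (rule zeta_pow_cong)
  with False show ?thesis by (simp add: chi_def dvd_mult_iff_p power_add)
qed (auto simp: chi_def dvd_mult_iff_p)

lemma chi_add: "chi j x * chi k x = chi (j + k) x"
  by (simp add: chi_def power_add distrib_right)

lemma chi_cong: "[j = k] (mod 8) \<Longrightarrow> chi j = chi k"
  by (simp add: chi_def fun_eq_iff) (meson cong_mult cong_refl zeta_pow_cong)

lemma d_1: "8 dvd d 1"
proof -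
  have "[d (1 * 1) = d 1 + d 1] (mod 8)" by (rule d_mult) (use p_pos in auto)
  then show ?thesis using cong_add_lcancel_0_nat cong_sym by (metis cong_0_iff mult_1)
qed

lemma chi_1 [simp]: "chi j 1 = 1"
  using d_1 p_pos by (simp add: chi_def zeta_pow_eq_1_iff zdvd_not_zless)

lemma chi_minus_1 [simp]: "chi j (-1) = 1"
  using d_minus_1 p_pos by (simp add: chi_def zeta_pow_eq_1_iff zdvd_not_zless)

lemma chi_minus: "chi j (- x) = chi j x"
  using chi_mult[of j "-1" x] by simp

lemma chi_zero [simp]: "chi j 0 = 0" by (simp add: chi_def)

lemma chi_0: "chi 0 x = (if p dvd x then 0 else 1)" by (simp add: chi_def)

text \<open>Scaling by an element of index 1 multiplies the sum by \<open>zeta ^ j\<close>, which is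
  not 1.\<close>

lemma sum_chi: assumes "\<not> 8 dvd j" shows "(\<Sum>x\<in>R. chi j x) = 0"
proof -
  obtain g where g: "\<not> p dvd g" "d g mod 8 = 1" using d_surj by blast
  have "[d g * j = 1 * j] (mod 8)" using g by (intro cong_mult) (simp_all add: Cong.cong_def)
  then have "chi j g = zeta ^ j"
    using g(1) zeta_pow_cong by (simp add: chi_def mult.commute)
  then have "chi j g \<noteq> 1" using assms by (simp add: zeta_pow_eq_1_iff)
  moreover have "(\<Sum>x\<in>R. chi j x) = chi j g * (\<Sum>x\<in>R. chi j x)"
    using sum_affine[OF chi_periodic g(1), of j 0] by (simp add: chi_mult sum_distrib_left)
  ultimately show ?thesis using mult_cancel_right1 by blast
qed

section \<open>Gauss sums and Jacobi sums\<close>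

definition G :: "nat \<Rightarrow> complex" where "G j = (\<Sum>x\<in>R. chi j x * e x)"

definition Jac :: "nat \<Rightarrow> nat \<Rightarrow> complex" where "Jac j k = (\<Sum>x\<in>R. chi j x * chi k (1 - x))"

lemma G_cong: "[j = k] (mod 8) \<Longrightarrow> G j = G k"
  by (simp add: G_def chi_cong)

lemma sum_R_split: "(\<Sum>x\<in>R. f x) = f 0 + (\<Sum>x\<in>R - {0}. f x)" for f :: "int \<Rightarrow> complex"
  using p_pos by (subst sum.remove[of _ 0]) auto

lemma R_nonzero: "x \<in> R - {0} \<Longrightarrow> \<not> p dvd x"
  by (auto simp: zdvd_not_zless)

lemma convolution:
  assumes "\<not> p dvd s"
  shows "(\<Sum>x\<in>R. chi j x * chi k (s - x)) = chi (j + k) s * Jac j k"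
proof -
  have per: "periodic (\<lambda>x. chi j x * chi k (s - x))"
    unfolding periodic_def
  proof
    fix x
    have "[s - x mod p = s - x] (mod p)" by (simp add: Cong.cong_def mod_diff_right_eq)
    then have "chi k (s - x mod p) = chi k (s - x)"
      by (rule periodic_cong[OF chi_periodic])
    then show "chi j (x mod p) * chi k (s - x mod p) = chi j x * chi k (s - x)"
      by (simp add: periodicD[OF chi_periodic])
  qed
  have "(\<Sum>x\<in>R. chi j x * chi k (s - x)) = (\<Sum>x\<in>R. chi j (s * x + 0) * chi k (s - (s * x + 0)))"
    by (rule sum_affine[symmetric, OF per assms])
  also have "\<dots> = (\<Sum>x\<in>R. chi (j + k) s * (chi j x * chi k (1 - x)))"
  proof (rule sum.cong[OF refl])
    fix x
    have "s - (s * x + 0) = s * (1 - x)" by (simp add: algebra_simps)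
    then show "chi j (s * x + 0) * chi k (s - (s * x + 0)) = chi (j + k) s * (chi j x * chi k (1 - x))"
      by (simp add: chi_mult flip: chi_add)
  qed
  finally show ?thesis by (simp add: Jac_def sum_distrib_left)
qed

text \<open>Sorting the double sum by \<open>s = x + y\<close> produces convolutions. The one at
  \<open>s = 0\<close> is a complete sum of a nontrivial character and drops out.\<close>

lemma G_mult:
  assumes "\<not> 8 dvd j + k"
  shows "G j * G k = Jac j k * G (j + k)"
proof -
  have "G j * G k = (\<Sum>x\<in>R. \<Sum>y\<in>R. chi j x * chi k y * e (x + y))"
    by (simp add: G_def sum_product e_add mult_ac)
  also have "\<dots> = (\<Sum>x\<in>R. \<Sum>s\<in>R. chi j x * chi k (s - x) * e s)"
  proof (rule sum.cong[OF refl])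
    fix x
    have per: "periodic (\<lambda>y. chi j x * chi k y * e (x + y))"
      unfolding periodic_def
      by (metis chi_periodic periodicD periodic_e mod_add_right_eq)
    show "(\<Sum>y\<in>R. chi j x * chi k y * e (x + y)) = (\<Sum>s\<in>R. chi j x * chi k (s - x) * e s)"
      using sum_affine[OF per, of 1 "-x"] p_pos by simp
  qed
  also have "\<dots> = (\<Sum>s\<in>R. (\<Sum>x\<in>R. chi j x * chi k (s - x)) * e s)"
    by (subst sum.swap) (simp add: sum_distrib_right)
  also have "\<dots> = (\<Sum>s\<in>R. Jac j k * (chi (j + k) s * e s))"
  proof (rule sum.cong[OF refl])
    fix s assume "s \<in> R"
    show "(\<Sum>x\<in>R. chi j x * chi k (s - x)) * e s = Jac j k * (chi (j + k) s * e s)"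
    proof (cases "s = 0")
      case True
      then show ?thesis using sum_chi[OF assms] by (simp add: chi_minus chi_add)
    next
      case False
      then show ?thesis using \<open>s \<in> R\<close> by (simp add: convolution R_nonzero)
    qed
  qed
  finally show ?thesis by (simp add: G_def sum_distrib_left)
qed

lemma G_0: assumes "8 dvd j" shows "G j = -1"
proof -
  have "G j = (\<Sum>x\<in>R. chi 0 x * e x)"
    using chi_cong[of j 0] assms by (simp add: G_def cong_0_iff)
  also have "\<dots> = (\<Sum>x\<in>R - {0}. e x)"
    unfolding sum_R_split by (simp add: chi_0 R_nonzero)
  also have "\<dots> = (\<Sum>x\<in>R. e (1 * x)) - 1"
    unfolding sum_R_split by simp
  finally show ?thesis unfolding sum_e using p_pos by simp
qed

text \<open>Substituting \<open>x = y * t\<close> separates the variables. Summation over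
  \<open>y\<close> then keeps only \<open>t = -1\<close>, apart from a vanishing character sum. The
  usual factor \<open>chi j (-1)\<close> is 1 here.\<close>

lemma G_conj:
  assumes "8 dvd j + k" "\<not> 8 dvd j"
  shows "G j * G k = of_int p"
proof -
  have jk: "chi j y * chi k y = 1" if "\<not> p dvd y" for y
    using chi_cong[of "j + k" 0] assms that by (simp add: chi_add cong_0_iff chi_0)
  have "G k * G j = (\<Sum>y\<in>R. \<Sum>x\<in>R. chi k y * e y * (chi j x * e x))"
    by (simp add: G_def sum_product)
  also have "\<dots> = (\<Sum>y\<in>R - {0}. \<Sum>x\<in>R. chi k y * e y * (chi j x * e x))"
    by (subst sum_R_split) simp
  also have "\<dots> = (\<Sum>y\<in>R - {0}. \<Sum>t\<in>R. chi j t * e ((t + 1) * y))"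
  proof (rule sum.cong[OF refl])
    fix y assume y: "y \<in> R - {0}"
    have per: "periodic (\<lambda>x. chi k y * e y * (chi j x * e x))"
      by (simp add: periodic_def periodicD[OF chi_periodic] periodicD[OF periodic_e])
    have *: "chi k y * e y * (chi j (y * t + 0) * e (y * t + 0)) = chi j t * e ((t + 1) * y)" for t
    proof -
      have "chi k y * e y * (chi j (y * t + 0) * e (y * t + 0)) =
          (chi j y * chi k y) * (chi j t * (e (t * y) * e y))"
        by (simp add: chi_mult mult_ac)
      then show ?thesis using jk[OF R_nonzero[OF y]] by (simp add: distrib_right e_add)
    qed
    have "(\<Sum>x\<in>R. chi k y * e y * (chi j x * e x)) =
          (\<Sum>x\<in>R. chi k y * e y * (chi j (y * x + 0) * e (y * x + 0)))"
      by (rule sum_affine[symmetric, OF per R_nonzero[OF y]])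
    also have "\<dots> = (\<Sum>t\<in>R. chi j t * e ((t + 1) * y))"
      unfolding * ..
    finally show "(\<Sum>x\<in>R. chi k y * e y * (chi j x * e x)) = (\<Sum>t\<in>R. chi j t * e ((t + 1) * y))" .
  qed
  also have "\<dots> = (\<Sum>t\<in>R. \<Sum>y\<in>R - {0}. chi j t * e ((t + 1) * y))" by (rule sum.swap)
  also have "\<dots> = (\<Sum>t\<in>R. chi j t * ((\<Sum>y\<in>R. e ((t + 1) * y)) - 1))"
    by (rule sum.cong[OF refl], subst sum_R_split) (simp add: sum_distrib_left)
  also have "\<dots> = (\<Sum>t\<in>R. if p dvd t + 1 then chi j t * of_int p else 0) - (\<Sum>t\<in>R. chi j t)"
    unfolding sum_e sum_subtractf[symmetric] by (rule sum.cong) (auto simp: algebra_simps)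
  also have "(\<Sum>t\<in>R. if p dvd t + 1 then chi j t * of_int p else 0) =
      (\<Sum>t\<in>{p - 1}. chi j t * of_int p)"
  proof (rule sum.mono_neutral_cong_right)
    have "t = p - 1" if "t \<in> R" "p dvd t + 1" for t using zdvd_imp_le[OF that(2)] that(1) by auto
    then show "\<forall>i\<in>R - {p - 1}. (if p dvd i + 1 then chi j i * of_int p else 0) = 0" by auto
  qed (use p_pos in auto)
  finally have "G k * G j = chi j (p - 1) * of_int p" using sum_chi[OF assms(2)] by simp
  also have "chi j (p - 1) = 1"
    using periodic_cong[OF chi_periodic, of "p - 1" "-1" j] by (simp add: cong_iff_dvd_diff)
  finally show ?thesis by (simp add: mult.commute)
qed

section \<open>Cosets of order eight and quadratic character sums over them\<close>

definition C :: "nat \<Rightarrow> int set"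
  where "C i = {x \<in> R. \<not> p dvd x \<and> d x mod 8 = i mod 8}"

text \<open>The quadratic character \<open>chi 4\<close>, kept integer-valued so that congruences
  modulo 4 make sense.\<close>

definition rho :: "int \<Rightarrow> int"
  where "rho x = (if p dvd x then 0 else if even (d x) then 1 else -1)"

text \<open>These integers are the coefficients of \<open>Jac j 4\<close> with respect to the powers
  of \<open>zeta ^ j\<close>.\<close>

definition S :: "nat \<Rightarrow> int" where "S i = (\<Sum>t\<in>C i. rho (1 - t))"

lemma C_subset: "C i \<subseteq> R" by (auto simp: C_def)

lemma finite_C [simp]: "finite (C i)" by (rule finite_subset[OF C_subset]) simp

lemma C_cong: "[i = k] (mod 8) \<Longrightarrow> C i = C k" by (simp add: C_def Cong.cong_def)

lemma chi_4: "chi 4 x = of_int (rho x)"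
  by (auto simp: chi_def rho_def power_mult zeta_powers)

lemma rho_mult: "rho (x * y) = rho x * rho y"
  using chi_mult[of 4 x y] by (simp add: chi_4 flip: of_int_mult)

lemma rho_minus: "rho (- x) = rho x"
  using chi_minus[of 4 x] by (simp add: chi_4)

lemma rho_cong: "[x = y] (mod p) \<Longrightarrow> rho x = rho y"
  using periodic_cong[OF chi_periodic, of x y 4] by (simp add: chi_4)

lemma sum_R_by_index:
  fixes f :: "int \<Rightarrow> complex"
  assumes "f 0 = 0"
  shows "(\<Sum>x\<in>R. f x) = (\<Sum>i<8. \<Sum>x\<in>C i. f x)"
proof -
  have "(\<Sum>x\<in>R. f x) = (\<Sum>x\<in>R - {0}. f x)" by (simp add: sum_R_split assms)
  also have "\<dots> = (\<Sum>i<8. \<Sum>x\<in>{x \<in> R - {0}. d x mod 8 = i}. f x)"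
    by (rule sum.group[symmetric]) auto
  also have "\<dots> = (\<Sum>i<8. \<Sum>x\<in>C i. f x)"
    by (intro sum.cong) (auto simp: C_def R_nonzero)
  finally show ?thesis .
qed

lemma chi_C: "x \<in> C i \<Longrightarrow> chi j x = zeta ^ (j * i)"
  by (auto simp: C_def chi_def Cong.cong_def intro!: zeta_pow_cong cong_mult)

lemma Jac_4: "Jac j 4 = (\<Sum>i<8. zeta ^ (j * i) * of_int (S i))"
  unfolding Jac_def
  by (subst sum_R_by_index) (auto simp: chi_C S_def chi_4 sum_distrib_left intro!: sum.cong)

lemma minv_C:
  assumes "x \<in> C i" "[i + k = 0] (mod 8)"
  shows "minv x \<in> C k"
proof -
  have x: "\<not> p dvd x" "[d x = i] (mod 8)" using assms(1) by (auto simp: C_def Cong.cong_def)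
  have "[d 1 = d (x * minv x)] (mod 8)"
    using periodic_cong[OF d_periodic minv(2)[OF x(1)]] by simp
  also have "[d (x * minv x) = d x + d (minv x)] (mod 8)" by (rule d_mult) (use x minv in auto)
  also have "[d x + d (minv x) = i + d (minv x)] (mod 8)" using x(2) by (intro cong_add) auto
  finally have "[i + d (minv x) = 0] (mod 8)" using d_1 by (metis cong_0_iff cong_sym cong_trans)
  then have "[i + d (minv x) = i + k] (mod 8)" using assms(2) by (metis cong_sym cong_trans)
  then have "[d (minv x) = k] (mod 8)" using cong_add_lcancel_nat by blast
  then show ?thesis using x(1) minv by (auto simp: C_def Cong.cong_def)
qed

text \<open>Modulo \<open>p\<close>, \<open>x * (1 - minv x)\<close> is \<open>- (1 - x)\<close>,
  while \<open>rho x\<close> is \<open>(-1) ^ i\<close> on \<open>C i\<close>.\<close>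

lemma rho_1_minus_minv:
  assumes "x \<in> C i"
  shows "rho (1 - minv x) = (-1) ^ i * rho (1 - x)"
proof -
  have x: "\<not> p dvd x" using assms by (simp add: C_def)
  have "[x * (1 - minv x) = - (1 - x)] (mod p)"
    using minv(2)[OF x] by (simp add: cong_iff_dvd_diff algebra_simps) (metis dvd_minus_iff minus_diff_eq)
  then have "rho (x * (1 - minv x)) = rho (1 - x)" by (metis rho_cong rho_minus)
  then have "rho x * rho (1 - minv x) = rho (1 - x)" by (simp add: rho_mult)
  moreover have "even (d x) \<longleftrightarrow> even i"
  proof -
    have "d x mod 8 = i mod 8" using assms by (simp add: C_def)
    then show ?thesis by (metis dvd_mod_iff even_numeral)
  qed
  ultimately show ?thesis using x by (cases "even i") (auto simp: rho_def)
qed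

text \<open>Inversion interchanges cosets of opposite index. This leaves only \<open>S 0\<close> to
  \<open>S 4\<close> as unknowns.\<close>

lemma S_inverse:
  assumes "[i + k = 0] (mod 8)"
  shows "S k = (-1) ^ i * S i"
proof -
  have ik: "[k + i = 0] (mod 8)" using assms by (simp add: add.commute)
  have mm: "minv (minv x) = x" if "x \<in> C j" for x j
    by (rule minv_minv) (use that in \<open>auto simp: C_def\<close>)
  have "S k = (\<Sum>t\<in>C i. rho (1 - minv t))" unfolding S_def
    by (rule sum.reindex_bij_witness[of _ minv minv])
      (use minv_C[OF _ assms] minv_C[OF _ ik] mm in auto)
  then show ?thesis by (simp add: rho_1_minus_minv S_def sum_distrib_left)
qed

text \<open>Orthogonality of characters applied to the indicator function of a coset; \<open>7 \<equiv> -1 (mod 8)\<close>.\<close>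

lemma sum_C:
  "8 * (\<Sum>x\<in>C i. f x) = (\<Sum>j<8. zeta ^ (7 * i * j) * (\<Sum>x\<in>R. chi j x * f x))"
proof -
  have ind: "(\<Sum>j<8. zeta ^ (7 * i * j) * chi j x) = (if x \<in> C i then 8 else 0)" if "x \<in> R" for x
  proof (cases "p dvd x")
    case False
    have "(\<Sum>j<8. zeta ^ (7 * i * j) * chi j x) = (\<Sum>j<8. zeta ^ (j * (7 * i + d x)))"
      by (rule sum.cong[OF refl])
        (simp add: chi_def False distrib_left power_add mult.commute[of _ "7 * i"])
    also have "\<dots> = (if 8 dvd 7 * i + d x then 8 else 0)" by (rule sum_zeta_pow)
    \<comment> \<open>Adding \<open>i\<close> turns \<open>7 * i\<close> into a multiple of 8 and
      avoids natural subtraction.\<close>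
    also have "8 dvd 7 * i + d x \<longleftrightarrow> [i + (7 * i + d x) = i + 0] (mod 8)"
      by (simp only: cong_add_lcancel_nat cong_0_iff)
    also have "\<dots> \<longleftrightarrow> d x mod 8 = i mod 8"
      by (simp add: Cong.cong_def flip: add.assoc)
    finally show ?thesis using False that by (simp add: C_def)
  qed (auto simp: chi_def C_def)
  have "(\<Sum>j<8. zeta ^ (7 * i * j) * (\<Sum>x\<in>R. chi j x * f x)) =
      (\<Sum>x\<in>R. (\<Sum>j<8. zeta ^ (7 * i * j) * chi j x) * f x)"
    by (simp add: sum_distrib_left sum_distrib_right sum.swap[of _ _ R] mult.assoc)
  also have "\<dots> = (\<Sum>x\<in>R. if x \<in> C i then 8 * f x else 0)"
    by (rule sum.cong[OF refl]) (simp add: ind)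
  also have "\<dots> = (\<Sum>x\<in>C i. 8 * f x)"
    using C_subset by (simp add: sum.If_cases Int_absorb1)
  finally show ?thesis by (simp add: sum_distrib_left)
qed

text \<open>Coset orthogonality applied to the constant 1: only the trivial character
  contributes.\<close>

lemma card_C: "8 * int (card (C i)) = p - 1"
proof -
  have "8 * complex_of_nat (card (C i)) = (\<Sum>j<8. zeta ^ (7 * i * j) * (\<Sum>x\<in>R. chi j x))"
    using sum_C[of "\<lambda>_. 1" i] by simp
  also have "\<dots> = (\<Sum>j<8::nat. if j = 0 then \<Sum>x\<in>R. chi 0 x else 0)"
  proof (rule sum.cong[OF refl])
    fix j :: nat assume "j \<in> {..<8}"
    then have "j = 0 \<or> \<not> 8 dvd j" by (auto dest: dvd_imp_le)
    then show "zeta ^ (7 * i * j) * (\<Sum>x\<in>R. chi j x) = (if j = 0 then \<Sum>x\<in>R. chi 0 x else 0)"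
      by (auto simp: sum_chi)
  qed
  also have "\<dots> = (\<Sum>x\<in>R. chi 0 x)" by simp
  also have "\<dots> = (\<Sum>x\<in>R - {0}. 1)" unfolding sum_R_split by (auto simp: chi_0 R_nonzero)
  also have "\<dots> = of_int (p - 1)" using p_pos by simp
  finally have "of_int (8 * int (card (C i))) = complex_of_int (p - 1)" by simp
  then show ?thesis by (simp only: of_int_eq_iff)
qed

lemma even_card_C: "even (card (C i))"
proof -
  have "p = 16 * (p div 16) + 1" using p_mod_16 by (metis mult_div_mod_eq)
  then have "int (card (C i)) = 2 * (p div 16)" using card_C[of i] by linarith
  then show ?thesis by (metis dvd_triv_left even_of_nat_iff)
qed

lemma rho_sign: assumes "t \<in> R" "t \<noteq> 1" shows "rho (1 - t) = 1 \<or> rho (1 - t) = -1"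
proof -
  have "\<not> p dvd 1 - t"
  proof
    assume "p dvd 1 - t"
    then have "t mod p = 1 mod p" by (metis mod_eq_dvd_iff)
    then show False using assms p_pos by simp
  qed
  then show ?thesis by (simp add: rho_def)
qed

lemma plus_minus_1_in_C0: "p - 1 \<in> C 0" "1 \<in> C 0"
proof -
  have "d (p - 1) = d (-1)"
    by (rule periodic_cong[OF d_periodic]) (simp add: cong_iff_dvd_diff)
  then show "p - 1 \<in> C 0" "1 \<in> C 0"
    using d_minus_1 d_1 p_pos by (auto simp: C_def mod_eq_0_iff_dvd dvd_diff_right_iff zdvd_not_zless)
qed

text \<open>Inversion pairs up the elements of \<open>C 0\<close> and \<open>C 4\<close> other than \<open>1\<close> and \<open>-1\<close>.\<close>

lemma S_cong_card:
  assumes "i = 0 \<or> i = 4"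
  shows "[(\<Sum>t\<in>C i - {1, p - 1}. rho (1 - t)) = int (card (C i - {1, p - 1}))] (mod 4)"
proof (rule sum_signs_cong_card[where f = minv])
  have ii: "[i + i = 0] (mod 8)" using assms by (auto simp: Cong.cong_def)
  fix x assume "x \<in> C i - {1, p - 1}"
  then have x: "x \<in> C i" "\<not> p dvd x" "x \<in> R" "x \<noteq> 1" "x \<noteq> p - 1" by (auto simp: C_def)
  show "minv (minv x) = x" by (rule minv_minv[OF x(2,3)])
  show ne: "minv x \<noteq> x" using minv_fixed[OF x(2,3)] x by auto
  have "p dvd (p - 1) * (p - 1) - 1" by (simp add: algebra_simps)
  then have "minv 1 = 1" "minv (p - 1) = p - 1"
    using p_pos by (auto intro!: modular_inverse_int_eqI simp: cong_iff_dvd_diff)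
  then show "minv x \<in> C i - {1, p - 1}"
    using minv_C[OF x(1) ii] \<open>minv (minv x) = x\<close> x by auto
  show "rho (1 - x) = 1 \<or> rho (1 - x) = -1" by (rule rho_sign[OF x(3,4)])
  show "rho (1 - minv x) = rho (1 - x)" using rho_1_minus_minv[OF x(1)] assms by auto
qed simp

text \<open>With \<open>c\<close> the common size of the cosets, pairing by inversion makes
  \<open>S 4\<close> congruent to \<open>c\<close> modulo 4 and \<open>S 0\<close> to
  \<open>c - 1\<close>: in \<open>C 0\<close> the unpaired 1 and -1 contribute
  \<open>rho 0 = 0\<close> and \<open>rho 2 = 1\<close>.\<close>

lemma S_mod_4:
  assumes "even (d 2)"
  shows "[S 0 - S 4 = -1] (mod 4)" "[S 0 + S 4 - 2 * S 2 = -1] (mod 4)"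
proof -
  define c where "c = int (card (C 0))"
  have c: "int (card (C i)) = c" for i using card_C[of i] card_C[of 0] by (simp add: c_def)
  have "even c" using even_card_C[of 0] by (simp add: c_def)
  have n2: "\<not> p dvd 2" using p_ge zdvd_not_zless by force
  have sub: "{1, p - 1} \<subseteq> C 0" using plus_minus_1_in_C0 by simp
  have "rho (1 - (p - 1)) = rho 2" by (rule rho_cong) (simp add: cong_iff_dvd_diff)
  also have "\<dots> = 1" using assms n2 by (simp add: rho_def)
  finally have "rho (1 - (p - 1)) = 1" .
  moreover have "rho (1 - 1) = 0" by (simp add: rho_def)
  ultimately have "(\<Sum>t\<in>{1, p - 1}. rho (1 - t)) = 1" using p_ge by simp
  then have "S 0 = 1 + (\<Sum>t\<in>C 0 - {1, p - 1}. rho (1 - t))"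
    unfolding S_def using sum.subset_diff[OF sub, of "\<lambda>t. rho (1 - t)"] by simp
  moreover have "int (card (C 0 - {1, p - 1})) = c - 2"
    using sub p_ge card_mono[OF finite_C sub] by (simp add: card_Diff_subset c_def of_nat_diff)
  ultimately have S0: "[S 0 = 1 + (c - 2)] (mod 4)"
    using S_cong_card[of 0] cong_add[OF cong_refl] by metis
  have "C 4 - {1, p - 1} = C 4" using plus_minus_1_in_C0 by (auto simp: C_def)
  then have S4: "[S 4 = c] (mod 4)" using S_cong_card[of 4] c by (simp add: S_def)
  have "1 \<notin> C 2" using plus_minus_1_in_C0 by (auto simp: C_def)
  \<comment> \<open>Inversion sends \<open>C 2\<close> to \<open>C 6\<close>, so it gives no pairing
    here. Parity suffices because \<open>S 2\<close> enters doubled.\<close>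
  have "even (S 2 - int (card (C 2)))"
  proof -
    have "S 2 - int (card (C 2)) = (\<Sum>t\<in>C 2. rho (1 - t) - 1)" by (simp add: S_def sum_subtractf)
    also have "even \<dots>"
    proof (rule dvd_sum)
      fix t assume "t \<in> C 2"
      then have "t \<in> R" "t \<noteq> 1" using \<open>1 \<notin> C 2\<close> by (auto simp: C_def)
      from rho_sign[OF this] show "even (rho (1 - t) - 1)" by auto
    qed
    finally show ?thesis .
  qed
  then have "even (S 2)" using c \<open>even c\<close> by simp
  from cong_sym[OF S0] obtain q0 where "S 0 = 1 + (c - 2) + 4 * q0" unfolding cong_iff_lin by blast
  moreover from cong_sym[OF S4] obtain q4 where "S 4 = c + 4 * q4" unfolding cong_iff_lin by blast
  moreover from \<open>even c\<close> obtain k where "c = 2 * k" by (elim evenE)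
  moreover from \<open>even (S 2)\<close> obtain l where "S 2 = 2 * l" by (elim evenE)
  ultimately have "S 0 - S 4 - (-1) = 4 * (q0 - q4)"
    "S 0 + S 4 - 2 * S 2 - (-1) = 4 * (k + q0 + q4 - l)" by simp_all
  then show "[S 0 - S 4 = -1] (mod 4)" "[S 0 + S 4 - 2 * S 2 = -1] (mod 4)"
    unfolding cong_iff_dvd_diff by (metis dvd_triv_left)+
qed

section \<open>Square roots and relations between Jacobi sums\<close>

lemma card_roots:
  assumes "c \<in> R"
  shows "int (card {y \<in> R. y\<^sup>2 mod p = c}) = 1 + rho c"
proof (cases "p dvd c")
  case True
  then have "c = 0" using assms R_nonzero by blast
  have "y = 0" if "y \<in> R" "y\<^sup>2 mod p = c" for y
  proof -
    have "p dvd y" using that \<open>c = 0\<close> prime by (metis mod_0_imp_dvd prime_dvd_power)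
    then show ?thesis using that(1) R_nonzero by blast
  qed
  moreover have "0 \<in> {y \<in> R. y\<^sup>2 mod p = c}" using p_pos \<open>c = 0\<close> by simp
  ultimately have "{y \<in> R. y\<^sup>2 mod p = c} = {0}" by blast
  then show ?thesis using True by (simp add: rho_def)
next
  case c: False
  show ?thesis
  proof (cases "even (d c)")
    case True
    then obtain z where "[z\<^sup>2 = c] (mod p)" using even_d_square c by blast
    define y where "y = z mod p"
    have y: "y \<in> R" "[y\<^sup>2 = c] (mod p)"
      using p_pos \<open>[z\<^sup>2 = c] (mod p)\<close> by (auto simp: y_def Cong.cong_def power_mod)
    have y0: "\<not> p dvd y"
    proof
      assume "p dvd y"
      then have "p dvd y\<^sup>2" by (simp add: power2_eq_square)
      then show False using y(2) c cong_dvd_iff by blast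
    qed
    then have "y \<noteq> 0" by auto
    have "{x \<in> R. x\<^sup>2 mod p = c} = {y, p - y}"
    proof (intro equalityI subsetI)
      fix x assume "x \<in> {x \<in> R. x\<^sup>2 mod p = c}"
      then have x: "x \<in> R" "[x\<^sup>2 = y\<^sup>2] (mod p)" using y assms by (auto simp: Cong.cong_def)
      then have "p dvd (x - y) * (x + y)"
        by (simp add: cong_iff_dvd_diff power2_eq_square algebra_simps)
      then have "p dvd x - y \<or> p dvd x + y" by (simp add: dvd_mult_iff_p)
      then show "x \<in> {y, p - y}"
      proof
        assume "p dvd x - y"
        then have "x mod p = y mod p" by (simp add: mod_eq_dvd_iff)
        then show ?thesis using x y by simp
      next
        assume "p dvd x + y"
        then have "p dvd x + y - p" by simp
        then have "x + y - p = 0"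
          using dvd_imp_le_int[of "x + y - p" p] x(1) y(1) \<open>y \<noteq> 0\<close> by force
        then show ?thesis by auto
      qed
    next
      fix x assume "x \<in> {y, p - y}"
      moreover have "[(p - y)\<^sup>2 = y\<^sup>2] (mod p)"
        by (simp add: cong_iff_dvd_diff power2_eq_square algebra_simps)
      then have "[(p - y)\<^sup>2 = c] (mod p)" using y(2) cong_trans by blast
      ultimately show "x \<in> {x \<in> R. x\<^sup>2 mod p = c}"
        using y \<open>y \<noteq> 0\<close> assms by (auto simp: Cong.cong_def)
    qed
    moreover have "y \<noteq> p - y"
    proof
      assume "y = p - y"
      then have "p = 2 * y" by simp
      then have "2 dvd p mod 16" by (simp add: dvd_mod_iff)
      then show False using p_mod_16 by simp
    qed
    ultimately show ?thesis using c True by (simp add: rho_def)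
  next
    case False
    have "y\<^sup>2 mod p \<noteq> c" for y
    proof
      assume "y\<^sup>2 mod p = c"
      then have yy: "[c = y * y] (mod p)" by (auto simp: Cong.cong_def power2_eq_square)
      then have "\<not> p dvd y" using c cong_dvd_iff by (metis dvd_mult)
      then have "[d c = d y + d y] (mod 8)"
        using d_mult periodic_cong[OF d_periodic yy] by metis
      then have "even (d c) \<longleftrightarrow> even (d y + d y)"
        by (metis cong_dvd_iff cong_dvd_modulus_nat even_numeral)
      then show False using False by simp
    qed
    then show ?thesis using c False by (simp add: rho_def)
  qed
qed

lemma Jac_commute: "Jac j k = Jac k j"
proof -
  have per: "periodic (\<lambda>x. chi j x * chi k (1 - x))"
    unfolding periodic_def
  proof
    fix x
    have "[1 - x mod p = 1 - x] (mod p)" by (simp add: Cong.cong_def mod_diff_right_eq)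
    then have "chi k (1 - x mod p) = chi k (1 - x)"
      by (rule periodic_cong[OF chi_periodic])
    then show "chi j (x mod p) * chi k (1 - x mod p) = chi j x * chi k (1 - x)"
      by (simp add: periodicD[OF chi_periodic])
  qed
  have "Jac j k = (\<Sum>x\<in>R. chi j (- 1 * x + 1) * chi k (1 - (- 1 * x + 1)))"
    unfolding Jac_def by (rule sum_affine[symmetric, OF per]) (use p_pos in auto)
  then show ?thesis by (simp add: Jac_def mult.commute)
qed

lemma not_dvd_2: "\<not> p dvd 2" using p_ge zdvd_not_zless by force

text \<open>This expresses squares of Gauss sums through the Jacobi sums with the quadratic
  character.\<close>

lemma Jac_diagonal:
  assumes "\<not> 8 dvd j"
  shows "chi j 4 * Jac j j = Jac j 4"
proof -
  let ?f = "\<lambda>y. chi j (1 - y\<^sup>2)"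
  have per: "periodic ?f"
    unfolding periodic_def
  proof
    fix x
    have "[(x mod p)\<^sup>2 = x\<^sup>2] (mod p)" by (simp add: Cong.cong_def power_mod)
    then have "[1 - (x mod p)\<^sup>2 = 1 - x\<^sup>2] (mod p)" using cong_diff cong_refl by blast
    then show "?f (x mod p) = ?f x" by (rule periodic_cong[OF chi_periodic])
  qed
  \<comment> \<open>\<open>4x(1 - x) = 1 - (2x - 1)\<^sup>2\<close>, and \<open>c\<close> has \<open>1 + \<rho>(c)\<close> square roots.\<close>
  have "chi j 4 * Jac j j = (\<Sum>x\<in>R. chi j (4 * (x * (1 - x))))"
    by (simp add: Jac_def sum_distrib_left chi_mult)
  also have "\<dots> = (\<Sum>x\<in>R. ?f (2 * x + (-1)))"
    by (rule sum.cong[OF refl], rule arg_cong[of _ _ "chi j"]) (simp add: power2_eq_square algebra_simps)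
  also have "\<dots> = (\<Sum>y\<in>R. ?f y)"
    by (rule sum_affine[OF per not_dvd_2])
  also have "\<dots> = (\<Sum>c\<in>R. \<Sum>y\<in>{y \<in> R. y\<^sup>2 mod p = c}. ?f y)"
    by (rule sum.group[symmetric]) (use p_pos in auto)
  also have "\<dots> = (\<Sum>c\<in>R. (1 + chi 4 c) * chi j (1 - c))"
  proof (rule sum.cong[OF refl])
    fix c assume c: "c \<in> R"
    have "(\<Sum>y\<in>{y \<in> R. y\<^sup>2 mod p = c}. ?f y) = (\<Sum>y\<in>{y \<in> R. y\<^sup>2 mod p = c}. chi j (1 - c))"
    proof (rule sum.cong[OF refl])
      fix y assume "y \<in> {y \<in> R. y\<^sup>2 mod p = c}"
      then have "[1 - y\<^sup>2 = 1 - c] (mod p)" by (intro cong_diff) (auto simp: Cong.cong_def)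
      then show "?f y = chi j (1 - c)" by (rule periodic_cong[OF chi_periodic])
    qed
    also have "\<dots> = of_int (int (card {y \<in> R. y\<^sup>2 mod p = c})) * chi j (1 - c)" by simp
    finally show "(\<Sum>y\<in>{y \<in> R. y\<^sup>2 mod p = c}. ?f y) = (1 + chi 4 c) * chi j (1 - c)"
      unfolding card_roots[OF c] by (simp add: chi_4)
  qed
  \<comment> \<open>The summand 1 leaves a complete character sum, which vanishes, and
    \<open>chi 4 c\<close> leaves the Jacobi sum.\<close>
  also have "\<dots> = (\<Sum>c\<in>R. chi j (- 1 * c + 1)) + Jac 4 j"
    by (simp add: Jac_def distrib_right sum.distrib)
  also have "(\<Sum>c\<in>R. chi j (- 1 * c + 1)) = 0"
    using sum_affine[OF chi_periodic, of "-1" j 1] sum_chi[OF assms] p_pos by simp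
  finally show ?thesis by (simp add: Jac_commute)
qed

text \<open>The convolutions over all \<open>s\<close> add up to 0; \<open>s = 0\<close> contributes
  \<open>p - 1\<close>, and each of the other \<open>p - 1\<close> residues contributes
  \<open>Jac j k\<close>.\<close>

lemma Jac_conj:
  assumes "8 dvd j + k" "\<not> 8 dvd j"
  shows "Jac j k = -1"
proof -
  have k: "\<not> 8 dvd k" using assms dvd_add_left_iff by blast
  have jk: "chi (j + k) = chi 0" by (rule chi_cong) (use assms in \<open>simp add: cong_0_iff\<close>)
  have "(\<Sum>s\<in>R. chi k (s - x)) = 0" for x
    using sum_affine[OF chi_periodic, of 1 k "- x"] sum_chi[OF k] p_pos by simp
  then have "0 = (\<Sum>x\<in>R. chi j x * (\<Sum>s\<in>R. chi k (s - x)))" by simp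
  also have "\<dots> = (\<Sum>s\<in>R. \<Sum>x\<in>R. chi j x * chi k (s - x))"
    unfolding sum_distrib_left by (rule sum.swap)
  also have "\<dots> = (\<Sum>x\<in>R. chi 0 x) + (\<Sum>s\<in>R - {0}. Jac j k)"
  proof -
    have "(\<Sum>x\<in>R. chi j x * chi k (0 - x)) = (\<Sum>x\<in>R. chi 0 x)"
      by (simp add: chi_minus chi_add jk)
    moreover have "(\<Sum>s\<in>R - {0}. \<Sum>x\<in>R. chi j x * chi k (s - x)) = (\<Sum>s\<in>R - {0}. Jac j k)"
      by (rule sum.cong[OF refl]) (simp add: convolution R_nonzero jk chi_0)
    ultimately show ?thesis by (subst sum_R_split) simp
  qed
  also have "(\<Sum>x\<in>R. chi 0 x) = of_int p - 1"
    unfolding sum_R_split[of "chi 0"] using p_pos by (simp add: chi_0 R_nonzero)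
  also have "(\<Sum>s\<in>R - {0}. Jac j k) = (of_int p - 1) * Jac j k" using p_pos by simp
  finally have *: "0 = of_int p - 1 + (of_int p - 1) * Jac j k" .
  have "(of_int p - 1) * (Jac j k + 1) = 0" unfolding distrib_left using * by (simp add: add.commute)
  moreover have "complex_of_int (p - 1) \<noteq> 0" using p_pos unfolding of_int_eq_0_iff by simp
  ultimately have "Jac j k + 1 = 0" by simp
  then show ?thesis by (simp add: eq_neg_iff_add_eq_0)
qed

text \<open>The character \<open>chi 0\<close> only removes the term \<open>x = 0\<close>, whose
  other factor is \<open>chi k 1 = 1\<close>.\<close>

lemma Jac_0: "\<not> 8 dvd k \<Longrightarrow> Jac 0 k = -1" "Jac 0 0 = of_int p - 2"
proof -
  have 1: "Jac 0 k = (\<Sum>x\<in>R. chi k (- 1 * x + 1)) - 1" for k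
    unfolding Jac_def sum_R_split by (simp add: chi_0 R_nonzero)
  have 2: "Jac 0 k = (\<Sum>x\<in>R. chi k x) - 1" for k
    unfolding 1 using sum_affine[OF chi_periodic, of "-1" k 1] p_pos by simp
  show "\<not> 8 dvd k \<Longrightarrow> Jac 0 k = -1" by (simp add: 2 sum_chi)
  show "Jac 0 0 = of_int p - 2"
    unfolding 2 sum_R_split[of "chi 0"] using p_pos by (simp add: chi_0 R_nonzero)
qed

lemma chi_4_even: "even (d 2) \<Longrightarrow> chi (2 * j) 4 = 1"
  and chi_4_odd: "even (d 2) \<Longrightarrow> odd j \<Longrightarrow> chi j 4 = (if 4 dvd d 2 then 1 else -1)"
proof -
  assume "even (d 2)"
  then obtain m where m: "d 2 = 2 * m" by (elim evenE)
  have "[d (2 * 2) = d 2 + d 2] (mod 8)" by (rule d_mult) (rule not_dvd_2)+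
  then have "[d 4 = 4 * m] (mod 8)" using m by simp
  then have "[j * d 4 = j * (4 * m)] (mod 8)" for j by (intro cong_mult) auto
  then have "zeta ^ (j * d 4) = zeta ^ (4 * (j * m))" for j
    using zeta_pow_cong by (metis mult.left_commute)
  moreover have "\<not> p dvd 4" using not_dvd_2 dvd_mult_iff_p[of 2 2] by simp
  ultimately have *: "chi j 4 = (-1) ^ (j * m)" for j
    by (simp add: chi_def power_mult zeta_powers)
  show "chi (2 * j) 4 = 1" by (simp add: * power_mult)
  assume "odd j"
  have "4 dvd d 2 \<longleftrightarrow> even m" using m by auto
  then show "chi j 4 = (if 4 dvd d 2 then 1 else -1)" using \<open>odd j\<close> by (simp add: *)
qed

section \<open>A cyclotomic number of order four\<close>

text \<open>Four times the indicator of the nonzero fourth powers is the sum of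
  \<open>chi 0\<close>, \<open>chi 2\<close>, \<open>chi 4\<close> and \<open>chi 6\<close>, so the
  count expands into sixteen Jacobi sums.\<close>

lemma cyclotomic_count:
  assumes "even (d 2)"
  shows "16 * int (card {x \<in> R. \<not> p dvd x \<and> \<not> p dvd 1 - x \<and> 4 dvd d x \<and> 4 dvd d (1 - x)}) =
    p - 11 + 6 * (S 0 + S 4 - 2 * S 2)" (is "16 * int (card ?Q) = _")
proof -
  let ?q = "\<lambda>x. chi 0 x + chi 2 x + chi 4 x + chi 6 x"
  have q: "?q x = (if \<not> p dvd x \<and> 4 dvd d x then 4 else 0)" for x
  proof (cases "p dvd x")
    case False
    have "zeta ^ (2 * m * d x) = zeta ^ (2 * m * (d x mod 4))" for m
    proof -
      have "2 * m * (4 * q + r) = 8 * (m * q) + 2 * m * r" for q r :: nat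
        by (simp add: algebra_simps)
      from this[of "d x div 4" "d x mod 4"]
      have "2 * m * d x = 8 * (m * (d x div 4)) + 2 * m * (d x mod 4)" by simp
      then show ?thesis by (simp only: power_add power_mult[of zeta 8]) (simp add: zeta_powers)
    qed
    from this[of 1] this[of 2] this[of 3]
    have "?q x = 1 + zeta ^ (2 * (d x mod 4)) + zeta ^ (4 * (d x mod 4)) + zeta ^ (6 * (d x mod 4))"
      using False by (simp add: chi_def)
    moreover have "d x mod 4 \<in> {0,1,2,3}" by auto
    moreover have "zeta ^ 12 = -1" "zeta ^ 18 = \<i>"
      using zeta_pow_mod[of 12] zeta_pow_mod[of 18] by (simp_all add: zeta_powers zeta_2)
    ultimately show ?thesis using False
      by (elim insertE) (simp_all add: zeta_2 zeta_powers mod_eq_0_iff_dvd[symmetric])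
  qed (simp add: chi_def)
  have S26: "S 6 = S 2" using S_inverse[of 2 6] by (simp add: Cong.cong_def)
  have S57: "S 5 = - S 3" "S 7 = - S 1" using S_inverse[of 3 5] S_inverse[of 1 7] by (simp_all add: Cong.cong_def)
  have "of_int (16 * int (card ?Q)) = (\<Sum>x\<in>R. if x \<in> ?Q then 16 else 0 :: complex)"
    by (simp add: sum.If_cases Int_def Collect_conj_eq[symmetric] conj_ac)
  also have "\<dots> = (\<Sum>x\<in>R. ?q x * ?q (1 - x))"
    by (rule sum.cong[OF refl]) (auto simp: q)
  also have "\<dots> = Jac 0 0 + Jac 0 2 + Jac 0 4 + Jac 0 6 + Jac 2 0 + Jac 2 2 + Jac 2 4 + Jac 2 6 +
      Jac 4 0 + Jac 4 2 + Jac 4 4 + Jac 4 6 + Jac 6 0 + Jac 6 2 + Jac 6 4 + Jac 6 6"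
    unfolding Jac_def by (simp add: algebra_simps sum.distrib)
  \<comment> \<open>\<open>Jac 0 0\<close> gives \<open>p - 2\<close>, the six sums with exactly one
    trivial character give -6, and the three conjugate pairs give -3. The other six reduce to three
    copies each of \<open>Jac 2 4\<close> and \<open>Jac 6 4\<close>.\<close>
  also have "\<dots> = of_int p - 11 + 3 * (Jac 2 4 + Jac 6 4)"
    using Jac_0(1)[of 2] Jac_0(1)[of 4] Jac_0(1)[of 6] Jac_0(2)
      Jac_commute[of 2 0] Jac_commute[of 4 0] Jac_commute[of 6 0] Jac_commute[of 4 2] Jac_commute[of 4 6]
      Jac_conj[of 2 6] Jac_conj[of 4 4] Jac_conj[of 6 2]
      Jac_diagonal[of 2] Jac_diagonal[of 6] chi_4_even[OF assms, of 1] chi_4_even[OF assms, of 3]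
    by simp
  also have "Jac 2 4 + Jac 6 4 = 2 * of_int (S 0 + S 4 - 2 * S 2)"
  proof -
    have "{..<8::nat} = {0,1,2,3,4,5,6,7}" by auto
    then show ?thesis
      unfolding Jac_4 by (simp add: S26 power_mult zeta_2 zeta_powers algebra_simps)
  qed
  finally have "of_int (16 * int (card ?Q)) = complex_of_int (p - 11 + 6 * (S 0 + S 4 - 2 * S 2))"
    by simp
  then show ?thesis by (simp only: of_int_eq_iff)
qed

section \<open>Explicit Jacobi sums and the quadratic forms they represent\<close>

lemma S_symmetry: "S 5 = - S 3" "S 6 = S 2" "S 7 = - S 1"
  using S_inverse[of 3 5] S_inverse[of 2 6] S_inverse[of 1 7] by (simp_all add: Cong.cong_def)

text \<open>Here \<open>zeta * (1 + \<i>)\<close>, which is \<open>zeta + zeta ^ 3\<close>, is a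
  square root of -2. Reading off \<open>b = S 1 + S 3\<close> and
  \<open>y = 2 * (S 1 - S 3)\<close>, the condition \<open>y = 2 * b\<close> means
  \<open>S 3 = 0\<close>, and \<open>y = - 2 * b\<close> means \<open>S 1 = 0\<close>.\<close>

lemma Jac_values:
  defines "K \<equiv> of_int (S 0 - S 4) + of_int (S 1 + S 3) * (zeta * (1 + \<i>))"
    and "K' \<equiv> of_int (S 0 - S 4) - of_int (S 1 + S 3) * (zeta * (1 + \<i>))"
    and "J \<equiv> of_int (S 0 + S 4 - 2 * S 2) + 2 * \<i> * of_int (S 1 - S 3)"
    and "J' \<equiv> of_int (S 0 + S 4 - 2 * S 2) - 2 * \<i> * of_int (S 1 - S 3)"
  shows "Jac 1 4 = K" "Jac 3 4 = K" "Jac 5 4 = K'" "Jac 7 4 = K'" "Jac 2 4 = J" "Jac 6 4 = J'"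
proof -
  have expand: "Jac j 4 = of_int (S 0) + zeta ^ j * of_int (S 1) + zeta ^ (2 * j mod 8) * of_int (S 2)
     + zeta ^ (3 * j mod 8) * of_int (S 3) + zeta ^ (4 * j mod 8) * of_int (S 4)
     - zeta ^ (5 * j mod 8) * of_int (S 3) + zeta ^ (6 * j mod 8) * of_int (S 2)
     - zeta ^ (7 * j mod 8) * of_int (S 1)" for j
  proof -
    have "{..<8::nat} = {0,1,2,3,4,5,6,7}" by auto
    then show ?thesis
      unfolding Jac_4 zeta_pow_mod by (simp add: S_symmetry mult.commute[of j])
  qed
  show "Jac 1 4 = K" "Jac 3 4 = K" "Jac 5 4 = K'" "Jac 7 4 = K'" "Jac 2 4 = J" "Jac 6 4 = J'"
    unfolding expand K_def K'_def J_def J'_def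
    by (simp_all add: zeta_2 zeta_powers) (simp_all add: algebra_simps)
qed

lemma G_4_square: "G 4 * G 4 = of_int p"
  by (rule G_conj) auto

lemma of_int_p_nonzero: "(of_int p :: complex) \<noteq> 0"
  using p_pos by simp

lemma G_4_nonzero: "G 4 \<noteq> 0"
  using G_4_square of_int_p_nonzero by auto

text \<open>Conjugate Gauss sums have product \<open>p\<close>, both before and after multiplication
  by \<open>G 4\<close>.\<close>

lemma norm_Jac:
  assumes "\<not> 8 dvd j" "\<not> 8 dvd j + 4" "8 dvd j + k" "\<not> 8 dvd k + 4"
  shows "Jac j 4 * Jac k 4 = of_int p"
proof -
  have "8 dvd (j + k) + 8" using assms(3) by simp
  then have jk: "8 dvd (j + 4) + (k + 4)" by (simp add: algebra_simps)
  have "(G j * G k) * (G 4 * G 4) = (G j * G 4) * (G k * G 4)" by simp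
  also have "\<dots> = (Jac j 4 * Jac k 4) * (G (j + 4) * G (k + 4))"
    by (simp add: G_mult assms)
  finally show ?thesis
    using G_conj[OF assms(3,1)] G_conj[OF jk assms(2)] G_4_square of_int_p_nonzero by simp
qed

lemma sum_of_two_squares: "p = (S 0 + S 4 - 2 * S 2)\<^sup>2 + (2 * (S 1 - S 3))\<^sup>2"
proof -
  have "of_int ((S 0 + S 4 - 2 * S 2)\<^sup>2 + (2 * (S 1 - S 3))\<^sup>2) = Jac 2 4 * Jac 6 4"
    unfolding Jac_values by (simp add: power2_eq_square algebra_simps)
  also have "\<dots> = complex_of_int p" by (rule norm_Jac) auto
  finally show ?thesis by (simp only: of_int_eq_iff)
qed

lemma square_plus_twice_square: "p = (S 0 - S 4)\<^sup>2 + 2 * (S 1 + S 3)\<^sup>2"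
proof -
  have "(zeta * (1 + \<i>)) * (zeta * (1 + \<i>)) = -2"
    using zeta_2 by (simp add: power2_eq_square algebra_simps flip: mult.assoc)
  moreover have "(u + v * w) * (u - v * w) = u * u - v * v * (w * w)" for u v w :: complex
    by (simp add: algebra_simps)
  ultimately have "of_int ((S 0 - S 4)\<^sup>2 + 2 * (S 1 + S 3)\<^sup>2) = Jac 1 4 * Jac 7 4"
    unfolding Jac_values by (simp add: power2_eq_square)
  also have "\<dots> = complex_of_int p" by (rule norm_Jac) auto
  finally show ?thesis by (simp only: of_int_eq_iff)
qed

section \<open>Gaussian periods\<close>

definition eta :: "nat \<Rightarrow> complex" where "eta i = (\<Sum>x\<in>C i. e x)"

lemma eta_expand: "8 * eta i = (\<Sum>j<8. zeta ^ (7 * i * j) * G j)"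
  unfolding eta_def G_def by (rule sum_C)

text \<open>The hypotheses on \<open>S\<close> say \<open>y = 2 * b\<close> and
  \<open>a + x = - 2 * \<epsilon>\<close>; the result is the product formula for every shift
  \<open>i\<close>.\<close>

lemma eta_product:
  assumes d2: "even (d 2)" and S3: "S 3 = 0" and S2: "S 2 - S 0 = (if 4 dvd d 2 then 1 else -1)"
  shows "16 * ((eta i + eta (i + 1)) * (eta (i + 4) + eta (i + 5))) = 1 - of_int p"
proof -
  define \<epsilon> :: complex where "\<epsilon> = (if 4 dvd d 2 then 1 else -1)"
  define a b x :: complex where "a = of_int (S 0 - S 4)" "b = of_int (S 1)" "x = of_int (S 0 + S 4 - 2 * S 2)"
  define t where "t = zeta * (1 + \<i>)"
  define v where "v = zeta ^ (7 * i)"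
  have eps: "\<epsilon>\<^sup>2 = 1" "\<epsilon> \<noteq> 0" by (simp_all add: \<epsilon>_def)
  have "a + x = - 2 * of_int (S 2 - S 0)" by (simp add: a_b_x_def)
  then have x: "a + x = - 2 * \<epsilon>" unfolding S2 \<epsilon>_def by simp
  have Jv: "Jac 1 4 = a + b * t" "Jac 3 4 = a + b * t" "Jac 5 4 = a - b * t" "Jac 7 4 = a - b * t"
    "Jac 2 4 = x + 2 * \<i> * b" "Jac 6 4 = x - 2 * \<i> * b"
    unfolding Jac_values a_b_x_def t_def using S3 by simp_all
  have chi: "chi j 4 = \<epsilon>" if "odd j" for j using chi_4_odd[OF d2 that] by (simp add: \<epsilon>_def)
  have Jd: "Jac j j = \<epsilon> * Jac j 4" if "odd j" for j
  proof -
    have "\<not> 8 dvd j" using that by auto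
    from Jac_diagonal[OF this] have "\<epsilon> * Jac j j = Jac j 4" by (simp add: chi[OF that])
    then have "\<epsilon>\<^sup>2 * Jac j j = \<epsilon> * Jac j 4" by (simp only: power2_eq_square mult.assoc)
    then show ?thesis by (simp add: eps)
  qed
  have G4: "G 1 * G 4 = (a + b * t) * G 5" "G 3 * G 4 = (a + b * t) * G 7"
    "G 5 * G 4 = (a - b * t) * G 1" "G 7 * G 4 = (a - b * t) * G 3"
    "G 2 * G 4 = (x + 2 * \<i> * b) * G 6" "G 6 * G 4 = (x - 2 * \<i> * b) * G 2"
    using G_mult[of 1 4] G_mult[of 3 4] G_mult[of 5 4] G_mult[of 7 4] G_mult[of 2 4] G_mult[of 6 4]
      G_cong[of 9 1] G_cong[of 11 3] G_cong[of 10 2] by (simp_all add: Jv Cong.cong_def del: One_nat_def)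
  have Gc: "G 1 * G 7 = of_int p" "G 3 * G 5 = of_int p" "G 2 * G 6 = of_int p"
    by (auto intro: G_conj)
  have Gs: "G 1 * G 1 = \<epsilon> * (a + b * t) * G 2" "G 3 * G 3 = \<epsilon> * (a + b * t) * G 6"
    "G 5 * G 5 = \<epsilon> * (a - b * t) * G 2" "G 7 * G 7 = \<epsilon> * (a - b * t) * G 6"
    using G_mult[of 1 1] G_mult[of 3 3] G_mult[of 5 5] G_mult[of 7 7]
      G_cong[of 10 2] G_cong[of 14 6] by (simp_all add: Jd Jv Cong.cong_def del: One_nat_def)
  \<comment> \<open>Division by \<open>G 4\<close> is replaced by multiplication, as
    \<open>G 4\<close> squares to \<open>p\<close>.\<close>
  have cancel: "u * v = c * G 4" if "u * G 4 = c * w" "w * v = of_int p" for u v w c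
  proof -
    have "(u * v) * G 4 = (u * G 4) * v" by simp
    also have "\<dots> = c * (w * v)" unfolding that(1) by simp
    also have "\<dots> = (c * G 4) * G 4" unfolding that(2) by (simp add: G_4_square)
    finally show ?thesis using G_4_nonzero by simp
  qed
  have G13: "G 1 * G 3 = (a + b * t) * G 4"
    by (rule cancel[OF G4(1)]) (simp add: Gc mult.commute)
  have G57: "G 5 * G 7 = (a - b * t) * G 4"
    by (rule cancel[OF G4(3)]) (simp only: Gc)
  have G22: "G 2 * G 2 = (x + 2 * \<i> * b) * G 4"
    by (rule cancel[OF G4(5)]) (simp add: Gc mult.commute)
  have G66: "G 6 * G 6 = (x - 2 * \<i> * b) * G 4"
    by (rule cancel[OF G4(6)]) (simp only: Gc)
  have "(a + b * t) * (a - b * t) = of_int p" using norm_Jac[of 1 7] by (simp add: Jv del: One_nat_def)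
  then have K0: "a + b * t \<noteq> 0" using of_int_p_nonzero by auto
  \<comment> \<open>The factor \<open>a + b * t\<close> trades \<open>G 5\<close> for
    \<open>G 1 * G 4\<close>, so that the known square of \<open>G 1\<close> applies; it is nonzero
    as a divisor of \<open>p\<close>.\<close>
  have G15: "G 1 * G 5 = \<epsilon> * (x + 2 * \<i> * b) * G 6"
  proof -
    have "(a + b * t) * (G 1 * G 5) = (G 1 * G 1) * G 4" using G4(1) by simp
    also have "\<dots> = (a + b * t) * (\<epsilon> * (G 2 * G 4))" unfolding Gs by simp
    finally show ?thesis using K0 unfolding G4 by simp
  qed
  have G37: "G 3 * G 7 = \<epsilon> * (x - 2 * \<i> * b) * G 2"
  proof -
    have "(a + b * t) * (G 3 * G 7) = (G 3 * G 3) * G 4" using G4(2) by simp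
    also have "\<dots> = (a + b * t) * (\<epsilon> * (G 6 * G 4))" unfolding Gs by simp
    finally show ?thesis using K0 unfolding G4 by simp
  qed
  \<comment> \<open>Twisting by powers of \<open>v\<close> encodes the shift by \<open>i\<close>.
    Exponents add modulo 8, so products of the \<open>g j\<close> obey the relations of the
    \<open>G j\<close>.\<close>
  define g where "g j = v ^ j * G j" for j
  have v8: "v ^ 8 = 1" unfolding v_def power_mult[symmetric] zeta_pow_eq_1_iff by simp
  have vred: "v ^ 10 = v ^ 2" "v ^ 12 = v ^ 4" "v ^ 14 = v ^ 6"
  proof -
    have "v ^ (8 + k) = v ^ k" for k by (simp only: power_add v8 mult_1)
    from this[of 2] this[of 4] this[of 6] show "v ^ 10 = v ^ 2" "v ^ 12 = v ^ 4" "v ^ 14 = v ^ 6" by simp_all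
  qed
  have gg: "g j * g k = v ^ (j + k) * (G j * G k)" for j k by (simp add: g_def power_add)
  have id: "(- 2 + (1 - \<i>) * g 2 + (1 + \<i>) * g 6)\<^sup>2 -
    ((1 - \<i> * zeta) * g 1 + (1 - zeta) * g 3 + (1 + \<i> * zeta) * g 5 + (1 + zeta) * g 7)\<^sup>2 = 4 - 4 * of_int p"
    by (rule octic_period_identity[where \<epsilon> = \<epsilon> and a = a and b = b and x = x and ?g4.0 = "g 4"])
      (use zeta_2 eps(1) x in \<open>simp_all add: gg Gs Gc G13 G57 G22 G66 G15 G37 v8 vred del: One_nat_def\<close>,
       simp_all add: g_def t_def del: One_nat_def)
  \<comment> \<open>Parts with even and odd \<open>j\<close> of
    \<open>8 * (eta i + eta (i + 1))\<close>. The term \<open>g 4\<close> has coefficient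
    \<open>1 + zeta ^ 4 = 0\<close>, and a shift by 4 negates only the odd part.\<close>
  define Ev Od where "Ev = - 2 + (1 - \<i>) * g 2 + (1 + \<i>) * g 6"
    "Od = (1 - \<i> * zeta) * g 1 + (1 - zeta) * g 3 + (1 + \<i> * zeta) * g 5 + (1 + zeta) * g 7"
  have set8: "{..<8::nat} = {0,1,2,3,4,5,6,7}" by auto
  have shift: "8 * eta (i + k) = (\<Sum>j<8. zeta ^ (7 * k * j mod 8) * g j)" for k
    unfolding eta_expand zeta_pow_mod
    by (rule sum.cong) (simp_all add: g_def v_def algebra_simps flip: power_add power_mult)
  have g0: "g 0 = -1" by (simp add: g_def G_0)
  have "8 * (eta i + eta (i + 1)) = Ev + Od"
    using shift[of 0] shift[of 1]
    by (simp add: set8 zeta_powers zeta_2 g0 Ev_Od_def distrib_left del: One_nat_def) (simp add: algebra_simps)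
  moreover have "8 * (eta (i + 4) + eta (i + 5)) = Ev - Od"
    using shift[of 4] shift[of 5]
    by (simp add: set8 zeta_powers zeta_2 g0 Ev_Od_def distrib_left del: One_nat_def) (simp add: algebra_simps)
  moreover have prod: "(8 * y) * (8 * z) = 4 * (16 * (y * z))" for y z :: complex by simp
  ultimately have "(8 * (eta i + eta (i + 1))) * (8 * (eta (i + 4) + eta (i + 5))) = (Ev + Od) * (Ev - Od)"
    by (simp only:)
  also have "\<dots> = Ev\<^sup>2 - Od\<^sup>2" by (simp add: power2_eq_square algebra_simps)
  also have "\<dots> = 4 * (1 - of_int p)" using id unfolding Ev_Od_def by simp
  finally have "4 * (16 * ((eta i + eta (i + 1)) * (eta (i + 4) + eta (i + 5)))) = 4 * (1 - of_int p)"
    unfolding prod .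
  then show ?thesis by (rule mult_left_cancel[THEN iffD1, rotated]) simp
qed

text \<open>Multiplication by \<open>k\<close> carries \<open>C i\<close> to the coset of index
  \<open>i + d k\<close>; at the level of characters it twists each Gauss sum.\<close>

lemma sum_C_e:
  assumes "\<not> p dvd k"
  shows "(\<Sum>x\<in>C i. e (k * x)) = eta (i + d k)"
proof -
  have G: "(\<Sum>x\<in>R. chi j x * e (k * x)) = zeta ^ (7 * d k * j) * G j" for j
  proof -
    have "zeta ^ (7 * d k * j) * chi j k = zeta ^ (8 * (d k * j))"
      using assms by (simp add: chi_def algebra_simps flip: power_add)
    also have "\<dots> = 1" by (simp add: zeta_pow_eq_1_iff)
    finally have 1: "zeta ^ (7 * d k * j) * chi j k = 1" .
    have "periodic (\<lambda>x. chi j x * e x)"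
      by (simp add: periodic_def periodicD[OF chi_periodic] periodicD[OF periodic_e])
    from sum_affine[OF this assms, of 0]
    have "G j = chi j k * (\<Sum>x\<in>R. chi j x * e (k * x))"
      by (simp add: G_def chi_mult sum_distrib_left mult.assoc)
    then have "zeta ^ (7 * d k * j) * G j = (zeta ^ (7 * d k * j) * chi j k) * (\<Sum>x\<in>R. chi j x * e (k * x))"
      by simp
    then show ?thesis by (simp add: 1)
  qed
  have "8 * (\<Sum>x\<in>C i. e (k * x)) = 8 * eta (i + d k)"
    unfolding sum_C eta_expand G
    by (rule sum.cong) (simp_all add: algebra_simps flip: power_add)
  then show ?thesis by simp
qed

lemma C_disjoint: "i mod 8 \<noteq> k mod 8 \<Longrightarrow> C i \<inter> C k = {}"
  by (auto simp: C_def)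

lemma suc_mod_8: "i mod 8 \<noteq> (i + 1) mod 8" for i :: nat
  by (simp add: mod_Suc)

lemma sum_C_union: "(\<Sum>x\<in>C i \<union> C (i + 1). f x) = (\<Sum>x\<in>C i. f x) + (\<Sum>x\<in>C (i + 1). f x)"
  by (rule sum.union_disjoint) (use C_disjoint[OF suc_mod_8] in auto)

lemma card_C_union: "4 * int (card (C i \<union> C (i + 1))) = p - 1"
  using card_C[of i] card_C[of "i + 1"] C_disjoint[OF suc_mod_8, of i] by (subst card_Un_disjoint) auto

text \<open>A nonzero frequency \<open>k\<close> only shifts the indices by \<open>d k\<close>, so
  the product formula for all shifts is exactly the Fourier condition.\<close>

lemma card_C_sum_representations:
  assumes "even (d 2)" "S 3 = 0" "S 2 - S 0 = (if 4 dvd d 2 then 1 else -1)" "g \<in> R"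
  shows "card {(s, t). s \<in> C i \<union> C (i + 1) \<and> t \<in> C (i + 4) \<union> C (i + 5) \<and> (s + t) mod p = g} =
    (if g = 0 then 0 else nat ((p - 1) div 16))"
proof (rule card_sum_representations)
  obtain q where q: "p = 16 * q + 1" using p_mod_16 by (metis mult_div_mod_eq)
  then have l: "p - 1 = 16 * int (nat ((p - 1) div 16))" using p_pos by simp
  have i5: "i + 5 = i + 4 + 1" by simp
  have "16 * int (card (C i \<union> C (i + 1)) * card (C (i + 4) \<union> C (i + 5))) = (4 * int (card (C i \<union> C (i + 1)))) * (4 * int (card (C (i + 4) \<union> C (i + 5))))"
    by simp
  also have "\<dots> = (p - 1) * (p - 1)" unfolding i5 card_C_union ..
  also have "\<dots> = 16 * (int (nat ((p - 1) div 16)) * (p - 1))" using l by simp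
  finally show "int (card (C i \<union> C (i + 1)) * card (C (i + 4) \<union> C (i + 5))) =
      int (nat ((p - 1) div 16)) * (p - 1)" by simp
  fix k assume k: "\<not> p dvd k"
  have "16 * ((\<Sum>s\<in>C i \<union> C (i + 1). e (k * s)) * (\<Sum>t\<in>C (i + 4) \<union> C (i + 5). e (k * t))) =
      1 - of_int p"
    using eta_product[OF assms(1-3), of "i + d k"]
    unfolding i5 sum_C_union sum_C_e[OF k] by (simp add: add_ac)
  also have "\<dots> = of_int (- (p - 1))" by simp
  also have "\<dots> = 16 * (- of_nat (nat ((p - 1) div 16)))" by (subst l) simp
  finally show "(\<Sum>s\<in>C i \<union> C (i + 1). e (k * s)) * (\<Sum>t\<in>C (i + 4) \<union> C (i + 5). e (k * t)) =
      - of_nat (nat ((p - 1) div 16))" by simp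
qed (use assms C_subset in auto)

section \<open>Signs for primes of the given form\<close>

lemma odd_card_quartic_pairs:
  "odd (card {x \<in> R. \<not> p dvd x \<and> \<not> p dvd 1 - x \<and> 4 dvd d x \<and> 4 dvd d (1 - x)}) \<longleftrightarrow> 4 dvd d 2"
  (is "odd (card ?Q) \<longleftrightarrow> _")
proof -
  \<comment> \<open>This is \<open>(p + 1) / 2\<close>, the residue of 1/2 and the only fixed point
    of \<open>x\<close> to \<open>1 - x\<close>; its index is minus that of 2 modulo 8.\<close>
  define h where "h = 8 * (p div 16) + 1"
  have h: "2 * h = p + 1" using mult_div_mod_eq[of 16 p] p_mod_16 by (simp add: h_def)
  have hR: "h \<in> R" using h p_pos by auto
  have h0: "\<not> p dvd h" using hR h p_pos by (auto dest: zdvd_imp_le)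
  have h1: "[1 - h = h] (mod p)" using h by (simp add: cong_iff_dvd_diff)
  have "[d (2 * h) = d 2 + d h] (mod 8)" by (rule d_mult[OF not_dvd_2 h0])
  moreover have "d (2 * h) = d 1"
    by (rule periodic_cong[OF d_periodic]) (simp add: h cong_iff_dvd_diff)
  ultimately have "8 dvd d 2 + d h" using d_1 by (metis cong_dvd_iff dvd_refl cong_0_iff cong_sym cong_trans)
  then have "4 dvd d 2 + d h" by (rule dvd_trans[rotated]) simp
  then have dh: "4 dvd d h \<longleftrightarrow> 4 dvd d 2" by (metis dvd_add_left_iff dvd_add_right_iff)
  have "p dvd 1 - h \<longleftrightarrow> p dvd h" using h1 by (metis Cong.cong_def dvd_mod_iff_p)
  then have hQ: "h \<in> ?Q \<longleftrightarrow> 4 dvd d 2"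
    using hR h0 dh periodic_cong[OF d_periodic h1] by auto
  have inv: "even (card (?Q - {h}))"
  proof (rule even_card_involution[where f = "\<lambda>x. (1 - x) mod p"])
    fix x assume x: "x \<in> ?Q - {h}"
    have c: "[1 - (1 - x) mod p = x] (mod p)" by (simp add: Cong.cong_def mod_diff_right_eq)
    show ff: "(1 - (1 - x) mod p) mod p = x" using c x by (simp add: Cong.cong_def)
    show ne: "(1 - x) mod p \<noteq> x"
    proof
      assume "(1 - x) mod p = x"
      then have "(1 - x) mod p = x mod p" using x by simp
      then have "p dvd 1 - x - x" by (simp add: mod_eq_dvd_iff)
      moreover have "2 * (x - h) = - (1 - x - x) - p" using h by simp
      ultimately have "p dvd 2 * (x - h)" by (simp only: dvd_minus_iff dvd_diff dvd_refl)
      then have "p dvd x - h" using not_dvd_2 dvd_mult_iff_p by blast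
      then have "x mod p = h mod p" by (simp add: mod_eq_dvd_iff)
      then show False using x hR by simp
    qed
    have dx: "d ((1 - x) mod p) = d (1 - x)" "d (1 - (1 - x) mod p) = d x"
      using periodicD[OF d_periodic] periodic_cong[OF d_periodic c] by auto
    have "p dvd 1 - (1 - x) mod p \<longleftrightarrow> p dvd x" using c by (metis Cong.cong_def dvd_mod_iff_p)
    moreover have "(1 - x) mod p \<noteq> h"
    proof
      assume "(1 - x) mod p = h"
      then have "x = (1 - h) mod p" using ff by simp
      then show False using x h1 hR by (simp add: Cong.cong_def)
    qed
    ultimately show "(1 - x) mod p \<in> ?Q - {h}" using x p_pos by (simp add: dx)
  qed
  have fin: "finite ?Q" by (rule finite_subset[of _ R]) auto
  show ?thesis
  proof (cases "h \<in> ?Q")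
    case True
    from card.remove[OF fin True] inv have "odd (card ?Q)" by (simp only: even_Suc not_not)
    then show ?thesis using True hQ by blast
  next
    case False
    then have "?Q - {h} = ?Q" by blast
    then show ?thesis using inv hQ False by metis
  qed
qed

lemma S_of_special_prime:
  fixes n u :: int
  assumes u: "u = n\<^sup>2" and p: "p = 4 * u\<^sup>2 + 12 * u + 1"
  shows "even (d 2)" "S 1 = 0 \<or> S 3 = 0" "S 2 - S 0 = (if 4 dvd d 2 then 1 else -1)"
proof -
  have par: "even k \<longleftrightarrow> even l" if "[k = l] (mod 8)" for k l :: nat
    using that by (metis Cong.cong_def dvd_mod_iff even_numeral)
  \<comment> \<open>\<open>(2u + 3)\<^sup>2 = p + 8\<close>, so \<open>8\<close> and hence \<open>2\<close> is a square modulo \<open>p\<close>.\<close>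
  show d2: "even (d 2)"
  proof -
    have "\<not> p dvd 2 * (2 * 2)" unfolding dvd_mult_iff_p using not_dvd_2 by simp
    moreover have c: "[(2 * u + 3) * (2 * u + 3) = 2 * (2 * 2)] (mod p)"
      unfolding p cong_iff_dvd_diff by (simp add: power2_eq_square algebra_simps)
    ultimately have "\<not> p dvd 2 * u + 3" by (metis Cong.cong_def dvd_mod_iff_p dvd_mult2)
    then have "[d ((2 * u + 3) * (2 * u + 3)) = d (2 * u + 3) + d (2 * u + 3)] (mod 8)" by (intro d_mult)
    moreover have "[d (2 * (2 * 2)) = d 2 + (d 2 + d 2)] (mod 8)"
    proof (rule cong_trans)
      have "\<not> p dvd 2 * 2" unfolding dvd_mult_iff_p using not_dvd_2 by simp
      then show "[d (2 * (2 * 2)) = d 2 + d (2 * 2)] (mod 8)" by (rule d_mult[OF not_dvd_2])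
      show "[d 2 + d (2 * 2) = d 2 + (d 2 + d 2)] (mod 8)"
        by (intro cong_add cong_refl d_mult not_dvd_2)
    qed
    ultimately have "even (d 2 + (d 2 + d 2)) \<longleftrightarrow> even (d (2 * u + 3) + d (2 * u + 3))"
      using periodic_cong[OF d_periodic c] par by metis
    then show ?thesis by simp
  qed
  define a b x y where "a = S 0 - S 4" "b = S 1 + S 3" "x = S 0 + S 4 - 2 * S 2" "y = 2 * (S 1 - S 3)"
  have "odd p" unfolding p by simp
  have xy: "p = x\<^sup>2 + 1 * y\<^sup>2" using sum_of_two_squares by (simp add: a_b_x_y_def)
  have ab: "p = a\<^sup>2 + 2 * b\<^sup>2" using square_plus_twice_square by (simp add: a_b_x_y_def)
  have "even y" by (simp add: a_b_x_y_def)
  then have "odd x" using xy \<open>odd p\<close> by (metis even_add even_mult_iff power2_eq_square)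
  have "odd a" using ab \<open>odd p\<close> by (metis even_add dvd_triv_left even_mult_iff power2_eq_square)
  \<comment> \<open>The middle terms match because \<open>u\<close> is \<open>n^2\<close>: both
    expand to \<open>4 * u^2 + 12 * u + 1\<close>.\<close>
  have un: "p = (2 * u - 1)\<^sup>2 + 1 * (4 * n)\<^sup>2" "p = (2 * u + 1)\<^sup>2 + 2 * (2 * n)\<^sup>2"
    unfolding p u by (simp_all add: power2_eq_square algebra_simps)
  have xu: "x\<^sup>2 = (2 * u - 1)\<^sup>2" "y\<^sup>2 = (4 * n)\<^sup>2"
    using prime_quadratic_form_unique[OF prime xy un(1)] \<open>odd x\<close> by simp_all
  have au: "a\<^sup>2 = (2 * u + 1)\<^sup>2" "b\<^sup>2 = (2 * n)\<^sup>2"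
    using prime_quadratic_form_unique[OF prime ab un(2)] \<open>odd a\<close> by simp_all
  \<comment> \<open>Thus \<open>S 1 - S 3\<close> and \<open>S 1 + S 3\<close> have equal squares,
    and the difference of these is \<open>4 * S 1 * S 3\<close>.\<close>
  have "y\<^sup>2 = 4 * b\<^sup>2" unfolding xu(2) au(2) by (simp add: power_mult_distrib)
  then have "S 1 * S 3 = 0" unfolding a_b_x_y_def by (simp add: power2_eq_square algebra_simps)
  then show "S 1 = 0 \<or> S 3 = 0" by simp
  obtain k where k: "x = 4 * k - 1"
    using cong_sym[OF S_mod_4(2)[OF d2]] unfolding cong_iff_lin a_b_x_y_def(3)[symmetric] by force
  obtain l where l: "a = 4 * l - 1"
    using cong_sym[OF S_mod_4(1)[OF d2]] unfolding cong_iff_lin a_b_x_y_def(1)[symmetric] by force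
  have x_cases: "x = 2 * u - 1 \<or> x = - (2 * u - 1)" and a_cases: "a = 2 * u + 1 \<or> a = - (2 * u + 1)"
    using xu(1) au(1) power2_eq_iff by blast+
  \<comment> \<open>Two integers that agree up to sign and are both -1 modulo 4 are equal.\<close>
  have sign: "z = v" if "z = v \<or> z = - v" "z = 4 * i - 1" "v = 4 * j - 1" for z v i j :: int
  proof (rule ccontr)
    assume "z \<noteq> v"
    with that have "2 * (i + j) = 1" by auto
    then show False by presburger
  qed
  define q where "q = int (card {x \<in> R. \<not> p dvd x \<and> \<not> p dvd 1 - x \<and> 4 dvd d x \<and> 4 dvd d (1 - x)})"
  have q: "16 * q = p - 11 + 6 * x" using cyclotomic_count[OF d2] by (simp add: q_def a_b_x_y_def)
  have q_odd: "odd q \<longleftrightarrow> 4 dvd d 2" using odd_card_quartic_pairs by (simp add: q_def)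
  have ax: "a + x = - 2 * (S 2 - S 0)" by (simp add: a_b_x_y_def)
  show "S 2 - S 0 = (if 4 dvd d 2 then 1 else -1)"
  proof (cases "even n")
    case True
    then obtain m where "n = 2 * m" by (elim evenE)
    then obtain w where w: "u = 4 * w" using u by (simp add: power2_eq_square)
    \<comment> \<open>Now \<open>u\<close> is 0 modulo 4, so \<open>2 * u - 1\<close> is -1 modulo 4
      and \<open>2 * u + 1\<close> is not.\<close>
    have x: "x = 2 * u - 1" by (rule sign[OF _ k, of _ "2 * w"]) (use x_cases w in auto)
    have "a = - (2 * u + 1)" by (rule sign[OF _ l, of _ "- 2 * w"]) (use a_cases w in auto)
    then have "S 2 - S 0 = 1" using ax x by simp
    moreover have "16 * q = 16 * (2 * (2 * w\<^sup>2 + 3 * w - 1) + 1)"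
      unfolding q p x w by (simp add: power2_eq_square algebra_simps)
    then have "q = 2 * (2 * w\<^sup>2 + 3 * w - 1) + 1"
      by (rule mult_left_cancel[THEN iffD1, rotated]) simp
    then have "odd q" by simp
    ultimately show ?thesis using q_odd by simp
  next
    case False
    then obtain m where "n = 2 * m + 1" by (elim oddE)
    then have "u = 4 * (m\<^sup>2 + m) + 1" using u by (simp add: power2_eq_square algebra_simps)
    then obtain w where w: "u = 4 * w + 1" by blast
    \<comment> \<open>Now \<open>u\<close> is 1 modulo 4, and both signs are reversed.\<close>
    have x: "x = - (2 * u - 1)" by (rule sign[OF _ k, of _ "- 2 * w"]) (use x_cases w in auto)
    have "a = 2 * u + 1" by (rule sign[OF _ l, of _ "2 * w + 1"]) (use a_cases w in auto)
    then have "S 2 - S 0 = -1" using ax x by simp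
    moreover have "16 * q = 16 * (2 * (2 * w\<^sup>2 + w))"
      unfolding q p x w by (simp add: power2_eq_square algebra_simps)
    then have "q = 2 * (2 * w\<^sup>2 + w)"
      by (rule mult_left_cancel[THEN iffD1, rotated]) simp
    then have "even q" by simp
    ultimately show ?thesis using q_odd by simp
  qed
qed

section \<open>Passing from the character to its fifth power\<close>

lemma five_times_mod_8: "5 * k mod 8 = i mod 8 \<longleftrightarrow> k mod 8 = 5 * i mod (8 :: nat)"
proof -
  have 25: "[5 * (5 * j) = j] (mod 8)" for j :: nat
    using cong_mult[of 25 1 8 j j] by (simp add: Cong.cong_def)
  have "[5 * k = i] (mod 8) \<longleftrightarrow> [k = 5 * i] (mod 8)"
  proof
    assume "[5 * k = i] (mod 8)"
    from cong_mult[OF cong_refl[of 5] this] show "[k = 5 * i] (mod 8)"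
      by (rule cong_trans[OF cong_sym[OF 25]])
  next
    assume "[k = 5 * i] (mod 8)"
    from cong_mult[OF cong_refl[of 5] this] show "[5 * k = i] (mod 8)"
      by (rule cong_trans[OF _ 25])
  qed
  then show ?thesis by (simp add: Cong.cong_def)
qed

text \<open>Since 5 is odd and its own inverse modulo 8, parity and surjectivity of the index
  survive; the element of new index 1 is \<open>g ^ 5\<close>.\<close>

lemma octic_index_times_5: "octic_index p (\<lambda>x. 5 * d x)"
proof
  obtain g where g: "\<not> p dvd g" "[d g = 1] (mod 8)" using d_surj by (auto simp: Cong.cong_def)
  have "[d (g ^ 5) = 5 * d g] (mod 8)"
  proof -
    have "\<not> p dvd g ^ k \<and> [d (g ^ k) = k * d g] (mod 8)" for k
    proof (induction k)
      case 0
      then show ?case using d_1 p_pos by (simp add: cong_0_iff zdvd_not_zless)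
    next
      case (Suc k)
      then have "[d (g * g ^ k) = d g + d (g ^ k)] (mod 8)" by (intro d_mult g) auto
      moreover have "[d g + d (g ^ k) = d g + k * d g] (mod 8)" using Suc by (intro cong_add) auto
      ultimately show ?case using Suc g(1) by (auto simp: dvd_mult_iff_p intro: cong_trans)
    qed
    then show ?thesis by blast
  qed
  then have "[5 * d (g ^ 5) = 5 * (5 * d g)] (mod 8)" by (intro cong_mult cong_refl)
  also have "[5 * (5 * d g) = 5 * (5 * 1)] (mod 8)" using g(2) by (intro cong_mult cong_refl)
  finally have "5 * d (g ^ 5) mod 8 = 1" by (simp add: Cong.cong_def)
  moreover have "\<not> p dvd g ^ 5" using g(1) prime prime_dvd_power by blast
  ultimately show "\<exists>g. \<not> p dvd g \<and> 5 * d g mod 8 = 1" by blast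
  show "periodic (\<lambda>x. 5 * d x)" using d_periodic by (simp add: periodic_def)
  show "[5 * d (x * y) = 5 * d x + 5 * d y] (mod 8)" if "\<not> p dvd x" "\<not> p dvd y" for x y
    using cong_mult[OF cong_refl[of 5] d_mult[OF that]] by simp
qed (use p_mod_16 d_minus_1 even_d_square in auto)

lemma C_times_5: "octic_index.C p (\<lambda>x. 5 * d x) i = C (5 * i)"
  unfolding octic_index.C_def[OF octic_index_times_5] C_def by (simp add: five_times_mod_8)

lemma S_times_5: "octic_index.S p (\<lambda>x. 5 * d x) i = S (5 * i)"
proof -
  have "octic_index.rho p (\<lambda>x. 5 * d x) = rho"
    unfolding octic_index.rho_def[OF octic_index_times_5] rho_def by (simp add: fun_eq_iff)
  then show ?thesis unfolding octic_index.S_def[OF octic_index_times_5] S_def C_times_5 by simp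
qed

end

subsection \<open>Primitive elements and cyclotomic cosets\<close>

lemma near_factorization_residue_ring:
  fixes p l :: nat
  assumes "p > 1" "l > 0" and AB: "A \<subseteq> {0..<int p}" "B \<subseteq> {0..<int p}"
    and card: "\<And>g. g \<in> {0..<int p} \<Longrightarrow>
      card {(s, t). s \<in> A \<and> t \<in> B \<and> (s + t) mod int p = g} = (if g = 0 then 0 else l)"
  shows "near_factorization (add_monoid (residue_ring (int p))) l A B"
proof -
  interpret residues "int p" "residue_ring (int p)" by unfold_locales (use assms in auto)
  have carrier: "carrier (residue_ring (int p)) = {0..<int p}"
    by (auto simp: residue_ring_def)
  have "finite A" "finite B" using AB finite_subset by blast+
  then have "finite {(s, t). s \<in> A \<and> t \<in> B \<and> (s + t) mod int p = 0}"
    by (rule_tac finite_subset[of _ "A \<times> B"]) auto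
  \<comment> \<open>Finiteness matters: \<open>card\<close> is 0 for infinite sets too.\<close>
  then have "{(s, t). s \<in> A \<and> t \<in> B \<and> (s + t) mod int p = 0} = {}"
    using card[of 0] assms(1) by simp
  then show ?thesis
    using card assms(2) AB a_group
    by (auto simp: near_factorization_def carrier res_add_eq res_zero_eq)
qed

locale primitive_residue =
  fixes p :: nat and \<alpha> :: int
  assumes prime: "prime p" and primitive: "primitive_element (residue_ring (int p)) \<alpha>"
begin

sublocale F: residues_prime p "residue_ring (int p)"
  by unfold_locales (use prime in auto)

sublocale M: group "mult_of (residue_ring (int p))"
  by (rule F.field_mult_group)

lemma pow_eq: "x \<in> {0..<int p} \<Longrightarrow> x [^]\<^bsub>mult_of (residue_ring (int p))\<^esub> (k::nat) = x ^ k mod int p"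
  using F.pow_cong[of x k] by (simp add: nat_pow_mult_of)

lemma carrier_mult_of_eq: "carrier (mult_of (residue_ring (int p))) = {0<..<int p}"
  by (auto simp: residue_ring_def)

lemma alpha: "\<alpha> \<in> carrier (mult_of (residue_ring (int p)))" "\<alpha> \<in> {0..<int p}"
    "generate (mult_of (residue_ring (int p))) {\<alpha>} = carrier (mult_of (residue_ring (int p)))"
  using primitive unfolding primitive_element_def carrier_mult_of_eq by auto

lemma finite_mult: "finite (carrier (mult_of (residue_ring (int p))))"
  by (simp add: carrier_mult_of_eq)

lemma generate_eq:
  assumes "x \<in> {0<..<int p}"
  shows "generate (mult_of (residue_ring (int p))) {x} = {x ^ k mod int p | k. True}"
proof -
  have "x \<in> carrier (mult_of (residue_ring (int p)))" unfolding carrier_mult_of_eq by (rule assms)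
  from M.generate_pow_on_finite_carrier[OF finite_mult this] show ?thesis
    using assms by (simp add: pow_eq)
qed

lemma not_dvd_iff: "\<not> int p dvd x \<longleftrightarrow> x mod int p \<in> {0<..<int p}"
proof -
  have "0 \<le> x mod int p" "x mod int p < int p" using F.m_gt_one by simp_all
  then show ?thesis unfolding dvd_eq_mod_eq_0 greaterThanLessThan_iff by (metis less_le)
qed

lemma not_dvd_alpha: "\<not> int p dvd \<alpha> ^ k"
proof -
  have "\<not> int p dvd \<alpha>" using alpha(1) unfolding carrier_mult_of_eq by (auto dest: zdvd_imp_le)
  moreover have "prime (int p)" using prime by simp
  ultimately show ?thesis using prime_dvd_power by blast
qed

lemma exists_index: assumes "\<not> int p dvd x" shows "\<exists>k. [\<alpha> ^ k = x] (mod int p)"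
proof -
  have "x mod int p \<in> {\<alpha> ^ k mod int p | k. True}"
    using assms alpha generate_eq[of \<alpha>] unfolding not_dvd_iff carrier_mult_of_eq by auto
  then show ?thesis by (auto simp: Cong.cong_def)
qed

lemma pow_alpha_cong:
  assumes "[\<alpha> ^ j = \<alpha> ^ k] (mod int p)"
  shows "[j = k] (mod (p - 1))"
proof -
  have "M.ord \<alpha> = p - 1"
    using M.generate_pow_card[OF alpha(1)] unfolding alpha(3) carrier_mult_of_eq by simp
  moreover have "\<alpha> [^]\<^bsub>mult_of (residue_ring (int p))\<^esub> j = \<alpha> [^]\<^bsub>mult_of (residue_ring (int p))\<^esub> k"
    using assms alpha(2) by (simp add: pow_eq Cong.cong_def)
  then have "\<alpha> [^]\<^bsub>mult_of (residue_ring (int p))\<^esub> int j = \<alpha> [^]\<^bsub>mult_of (residue_ring (int p))\<^esub> int k"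
    by (simp add: int_pow_int)
  ultimately have "int (p - 1) dvd int j - int k"
    using M.int_pow_eq[OF alpha(1)] by (metis dvd_diff_commute)
  then show ?thesis by (metis cong_iff_dvd_diff cong_int_iff)
qed

text \<open>A discrete logarithm, meaningful only modulo \<open>p - 1\<close>. The chosen predicate
  depends only on the residue of \<open>x\<close>, which makes \<open>ind\<close> periodic.\<close>

definition ind :: "int \<Rightarrow> nat" where "ind x = (SOME k. [\<alpha> ^ k = x] (mod int p))"

lemma ind: "\<not> int p dvd x \<Longrightarrow> [\<alpha> ^ ind x = x] (mod int p)"
  unfolding ind_def by (rule someI_ex) (rule exists_index)

lemma ind_mod: "ind (x mod int p) = ind x"
  by (simp add: ind_def Cong.cong_def)

lemma ind_eqI: "[\<alpha> ^ k = x] (mod int p) \<Longrightarrow> [ind x = k] (mod (p - 1))"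
proof -
  assume x: "[\<alpha> ^ k = x] (mod int p)"
  then have "\<not> int p dvd x" using cong_dvd_iff not_dvd_alpha by blast
  then have "[\<alpha> ^ ind x = \<alpha> ^ k] (mod int p)" using ind cong_sym[OF x] cong_trans by blast
  then show ?thesis by (rule pow_alpha_cong)
qed

lemma octic_index_ind:
  assumes "16 dvd p - 1"
  shows "octic_index (int p) ind"
proof -
  have p1: "p > 1" using prime by (rule prime_gt_1_nat)
  have mod8: "[j = k] (mod 8)" if "[j = k] (mod (p - 1))" for j k
    by (rule cong_dvd_modulus_nat[OF that]) (use assms in \<open>auto intro: dvd_trans[rotated]\<close>)
  interpret prime_modulus "int p" by unfold_locales (use prime in auto)
  show ?thesis
  proof
    obtain q where "p - 1 = 16 * q" using assms by (elim dvdE)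
    then have "int p = 16 * int q + 1" using p1 by simp
    then show "int p mod 16 = 1" by simp
    show "periodic ind" by (simp add: periodic_def ind_mod)
    show "[ind (x * y) = ind x + ind y] (mod 8)" if "\<not> int p dvd x" "\<not> int p dvd y" for x y
      by (rule mod8, rule ind_eqI) (use cong_mult[OF ind[OF that(1)] ind[OF that(2)]] in \<open>simp add: power_add\<close>)
    have "[ind \<alpha> = 1] (mod 8)" by (rule mod8, rule ind_eqI) simp
    then show "\<exists>g. \<not> int p dvd g \<and> ind g mod 8 = 1"
      using not_dvd_alpha[of 1] by (auto simp: Cong.cong_def)
    show "8 dvd ind (- 1)"
    proof -
      have "\<not> int p dvd - 1" using p1 by (simp add: zdvd_not_zless)
      from cong_mult[OF ind[OF this] ind[OF this]]
      have "[\<alpha> ^ (2 * ind (- 1)) = \<alpha> ^ 0] (mod int p)" by (simp add: power_add mult_2)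
      \<comment> \<open>Here divisibility of \<open>p - 1\<close> by 16, and not just 8, yields an
        index of -1 divisible by 8.\<close>
      from pow_alpha_cong[OF this] have "p - 1 dvd 2 * ind (- 1)" by (simp add: cong_0_iff)
      with assms have "16 dvd 2 * ind (- 1)" by (rule dvd_trans)
      then obtain j where "2 * ind (- 1) = 16 * j" by (elim dvdE)
      then have "ind (- 1) = 8 * j" by simp
      then show ?thesis by simp
    qed
    show "\<exists>y. [y\<^sup>2 = x] (mod int p)" if "\<not> int p dvd x" "even (ind x)" for x
    proof -
      from that(2) obtain m where "ind x = 2 * m" by (elim evenE)
      then show ?thesis using ind[OF that(1)] by (metis power_mult mult.commute)
    qed
  qed
qed

lemma cyclotomic_coset_eq_C:
  assumes "16 dvd p - 1"
  shows "cyclotomic_coset (residue_ring (int p)) 8 \<alpha> i = octic_index.C (int p) ind i"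
proof -
  have mod8: "[j = k] (mod 8)" if "[j = k] (mod (p - 1))" for j k
    by (rule cong_dvd_modulus_nat[OF that]) (use assms in \<open>auto intro: dvd_trans[rotated]\<close>)
  have p1: "p > 1" using prime by (rule prime_gt_1_nat)
  have a8: "\<alpha> ^ 8 mod int p \<in> {0<..<int p}" using not_dvd_alpha not_dvd_iff by blast
  have "cyclotomic_coset (residue_ring (int p)) 8 \<alpha> i = {\<alpha> ^ (i + 8 * k) mod int p | k. True}"
    unfolding cyclotomic_coset_def pow_eq[OF alpha(2)] generate_eq[OF a8] l_coset_def
    by (auto simp: F.res_mult_eq power_mod mod_mult_eq power_add power_mult)
  also have "\<dots> = octic_index.C (int p) ind i"
    unfolding octic_index.C_def[OF octic_index_ind[OF assms]]
  proof (intro equalityI subsetI)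
    fix x assume "x \<in> {\<alpha> ^ (i + 8 * k) mod int p | k. True}"
    then obtain k where k: "x = \<alpha> ^ (i + 8 * k) mod int p" by blast
    then have "[ind x = i + 8 * k] (mod 8)" by (intro mod8 ind_eqI) (simp add: Cong.cong_def)
    then show "x \<in> {x \<in> {0..<int p}. \<not> int p dvd x \<and> ind x mod 8 = i mod 8}"
      using k not_dvd_alpha[of "i + 8 * k"] p1 by (simp add: Cong.cong_def dvd_mod_iff)
  next
    fix x assume "x \<in> {x \<in> {0..<int p}. \<not> int p dvd x \<and> ind x mod 8 = i mod 8}"
    then have x: "x \<in> {0..<int p}" "\<not> int p dvd x" "[ind x = i] (mod 8)" by (auto simp: Cong.cong_def)
    have "8 dvd p - 1" using assms by (rule dvd_trans[rotated]) simp
    \<comment> \<open>Adding a multiple of \<open>p - 1\<close> leaves the power of \<alpha>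
      unchanged and makes the exponent at least \<open>i\<close>, so that natural subtraction is
      safe.\<close>
    then have "[ind x + (p - 1) * i = i + 0] (mod 8)" using x(3) by (intro cong_add) (auto simp: cong_0_iff)
    moreover have "i \<le> ind x + (p - 1) * i" using p1 by (cases "p - 1") auto
    ultimately have "8 dvd ind x + (p - 1) * i - i" by (simp add: cong_altdef_nat)
    then obtain k where "ind x + (p - 1) * i - i = 8 * k" by (elim dvdE)
    then have k: "ind x + (p - 1) * i = i + 8 * k" using \<open>i \<le> ind x + (p - 1) * i\<close> by simp
    have ord: "Coset.order (mult_of (residue_ring (int p))) = p - 1"
      unfolding Coset.order_def carrier_mult_of_eq by simp
    have "[\<alpha> ^ (p - 1) = 1] (mod int p)"
      using M.pow_order_eq_1[OF alpha(1)] p1 unfolding ord pow_eq[OF alpha(2)]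
      by (simp add: Cong.cong_def F.res_one_eq)
    then have "[\<alpha> ^ ind x * (\<alpha> ^ (p - 1)) ^ i = x * 1 ^ i] (mod int p)"
      using ind[OF x(2)] by (intro cong_mult cong_pow)
    then have "\<alpha> ^ (i + 8 * k) mod int p = x"
      unfolding k[symmetric] using x(1) by (simp add: Cong.cong_def power_add power_mult)
    then show "x \<in> {\<alpha> ^ (i + 8 * k) mod int p | k. True}" by blast
  qed
  finally show ?thesis .
qed

end

theorem theorem1p3:
  fixes n u p :: nat and \<alpha> :: int
  defines "F \<equiv> residue_ring (int p)"
  defines "C \<equiv> cyclotomic_coset F 8 \<alpha>"
  defines "NF \<equiv> sized_near_factorization (add_monoid F) ((p - 1) div 4) ((p - 1) div 4) ((p - 1) div 16)"
  assumes "n \<ge> 1" and "u = n ^ 2"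
    and "p = 4 * u ^ 2 + 12 * u + 1" and "prime p"
    and "primitive_element F \<alpha>"
  shows "(NF (C 0 \<union> C 1) (C 4 \<union> C 5) \<and> NF (C 0 \<union> C 7) (C 3 \<union> C 4)) \<or>
         (NF (C 0 \<union> C 5) (C 1 \<union> C 4) \<and> NF (C 0 \<union> C 3) (C 4 \<union> C 7))"
proof -
  have dvd16: "16 dvd p - 1" using assms(5,6) by (rule sixteen_dvd)
  interpret P: primitive_residue p \<alpha>
    using assms by unfold_locales auto
  interpret D: octic_index "int p" P.ind by (rule P.octic_index_ind[OF dvd16])
  interpret D5: octic_index "int p" "\<lambda>x. 5 * P.ind x" by (rule D.octic_index_times_5)
  have p: "int u = (int n)\<^sup>2" "int p = 4 * (int u)\<^sup>2 + 12 * int u + 1"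
    using assms(5,6) by simp_all
  have C: "C i = D.C i" for i
    unfolding C_def F_def by (rule P.cyclotomic_coset_eq_C[OF dvd16])
  have CC: "C i = C k" if "i mod 8 = k mod 8" for i k
    unfolding C by (rule D.C_cong) (use that in \<open>simp add: Cong.cong_def\<close>)
  have p17: "p \<ge> 17" using D.p_ge by simp
  \<comment> \<open>Stated for an arbitrary index \<open>d\<close>, to serve both
    \<open>P.ind\<close> and its fivefold multiple.\<close>
  have NF: "NF (c i \<union> c (i + 1)) (c (i + 4) \<union> c (i + 5))"
    if c: "octic_index (int p) d" "c = octic_index.C (int p) d" and S: "even (d 2)"
      "octic_index.S (int p) d 3 = 0"
      "octic_index.S (int p) d 2 - octic_index.S (int p) d 0 = (if 4 dvd d 2 then 1 else -1)"
    for c d i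
  proof -
    interpret X: octic_index "int p" d by (rule c)
    have "card (c i \<union> c (i + 1)) = (p - 1) div 4" for i
      using X.card_C_union[of i] unfolding c(2) by linarith
    from this[of i] this[of "i + 4"]
    have "card (c i \<union> c (i + 1)) = (p - 1) div 4" "card (c (i + 4) \<union> c (i + 5)) = (p - 1) div 4"
      by (simp_all add: add.commute)
    moreover have "nat ((int p - 1) div 16) = (p - 1) div 16"
      using p17 by (simp add: nat_div_distrib nat_diff_distrib)
    then have "near_factorization (add_monoid F) ((p - 1) div 16) (c i \<union> c (i + 1)) (c (i + 4) \<union> c (i + 5))"
      unfolding F_def c(2) using X.card_C_sum_representations[OF S] X.C_subset p17
      by (intro near_factorization_residue_ring) auto
    ultimately show ?thesis by (simp add: NF_def sized_near_factorization_def)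
  qed
  note special = D.S_of_special_prime[OF p]
  from special(2) show ?thesis
  proof
    assume "D.S 3 = 0"
    then have "NF (C i \<union> C (i + 1)) (C (i + 4) \<union> C (i + 5))" for i
      unfolding C using D.octic_index_axioms special by (intro NF) auto
    \<comment> \<open>The shift 7 wraps around: indices 7, 8, 11, 12 become 7, 0, 3, 4.\<close>
    from this[of 0] this[of 7] CC[of 8 0] CC[of 11 3] CC[of 12 4]
    show ?thesis by (simp add: Un_commute)
  next
    assume "D.S 1 = 0"
    moreover have "D.S 15 = D.S 7" unfolding D.S_def using D.C_cong[of 15 7] by (simp add: Cong.cong_def)
    \<comment> \<open>The new \<open>S 3\<close> is the old \<open>S 15\<close>, that is
      \<open>S 7 = - S 1\<close>.\<close>
    ultimately have "D5.S 3 = 0" using D.S_times_5[of 3] D.S_symmetry by simp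
    then have "NF (D5.C i \<union> D5.C (i + 1)) (D5.C (i + 4) \<union> D5.C (i + 5))" for i
      using D5.octic_index_axioms D5.S_of_special_prime[OF p] by (intro NF) auto
    \<comment> \<open>Multiplying by 5, the shift 0 gives indices 0, 5, 4, 1 and the shift 7 gives
      3, 0, 7, 4 modulo 8.\<close>
    from this[of 0] this[of 7] CC[of 20 4] CC[of 25 1] CC[of 35 3] CC[of 40 0] CC[of 55 7] CC[of 60 4]
    show ?thesis unfolding D.C_times_5 by (simp add: Un_commute flip: C)
  qed
qed

end
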